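(* Let $d\geq 0$ and let $\gamma$ be an integer with $(d+2)/5\geq\gamma\geq 0$. Then $k(d,\gamma)=\lfloor (d-\gamma+1)/2\rfloor$.
   Context: A graph $G=(V,E)$ is $k$-linked if $|V|\geq 2k$ and for every choice of $2k$ distinct vertices $s_1,\dots,s_k,t_1,\dots,t_k$ there exist $k$ pairwise vertex-disjoint paths $L_1,\dots,L_k$ with $L_i$ joining $s_i$ and $t_i$; a polytope is $k$-linked if its graph (vertices and edges) is. For a polytope $P$, $k(P)=\max\{k : P \text{ is } k\text{-linked}\}$. For $d,\gamma\geq 0$ let $\mathcal{P}_d^\gamma$ be the class of $d$-polytopes with $d+\gamma+1$ vertices, and $k(d,\gamma)=\max\{k : k(P)\geq k \text{ for all } P\in\mathcal{P}_d^\gamma\}$. *)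

theory Defs
  imports "HOL-Analysis.Analysis"
begin

text \<open>A simple graph is given by its vertex set \<open>V\<close> and its set \<open>E\<close> of unordered pairs
  \<open>{u, v}\<close>. A path is the list of its vertices.\<close>

definition graph_path :: "'v set \<Rightarrow> 'v set set \<Rightarrow> 'v list \<Rightarrow> bool" where
  "graph_path V E p \<longleftrightarrow>
     p \<noteq> [] \<and> distinct p \<and> set p \<subseteq> V \<and> successively (\<lambda>u v. {u, v} \<in> E) p"

text \<open>Only finite graphs are considered; the finiteness conjunct keeps \<open>card V\<close> meaningful.
  The terminals are \<open>s 0, \<dots>, s (k - 1)\<close> and \<open>t 0, \<dots>, t (k - 1)\<close>.\<close>

definition k_linked :: "'v set \<Rightarrow> 'v set set \<Rightarrow> nat \<Rightarrow> bool" where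
  "k_linked V E k \<longleftrightarrow>
     finite V \<and> 2 * k \<le> card V \<and>
     (\<forall>s t. s ` {..<k} \<subseteq> V \<and> t ` {..<k} \<subseteq> V \<and>
            inj_on s {..<k} \<and> inj_on t {..<k} \<and> s ` {..<k} \<inter> t ` {..<k} = {} \<longrightarrow>
        (\<exists>L. (\<forall>i<k. graph_path V E (L i) \<and> hd (L i) = s i \<and> last (L i) = t i) \<and>
             (\<forall>i<k. \<forall>j<k. i \<noteq> j \<longrightarrow> set (L i) \<inter> set (L j) = {})))"

definition polytope_vertices :: "'a::euclidean_space set \<Rightarrow> 'a set" where
  "polytope_vertices P = {v. v extreme_point_of P}"

text \<open>An edge, as a one-dimensional face of a polytope, is the segment between its two
  vertices; in the graph it is represented by the pair of these vertices.\<close>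

definition polytope_edges :: "'a::euclidean_space set \<Rightarrow> 'a set set" where
  "polytope_edges P =
     {{u, v} | u v. u \<in> polytope_vertices P \<and> v \<in> polytope_vertices P \<and>
                    closed_segment u v edge_of P}"

definition polytope_linked :: "'a::euclidean_space set \<Rightarrow> nat \<Rightarrow> bool" where
  "polytope_linked P k \<longleftrightarrow> k_linked (polytope_vertices P) (polytope_edges P) k"

text \<open>The set below is finite, because \<open>k\<close> is at most half the number of vertices, and it
  contains 0.\<close>

definition linkedness :: "'a::euclidean_space set \<Rightarrow> nat" where
  "linkedness P = Max {k. polytope_linked P k}"

text \<open>The \<open>d\<close>-polytopes need not be full-dimensional in the ambient space \<open>'a\<close>.\<close>

definition polytope_class :: "nat \<Rightarrow> nat \<Rightarrow> 'a::euclidean_space set set" where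
  "polytope_class d \<gamma> =
     {P. polytope P \<and> aff_dim P = int d \<and> card (polytope_vertices P) = d + \<gamma> + 1}"

text \<open>The type argument is the ambient space of the polytopes. It has to be of dimension at
  least \<open>d\<close>: otherwise the class is empty and the maximum does not exist.\<close>

definition min_linkedness :: "'a::euclidean_space itself \<Rightarrow> nat \<Rightarrow> nat \<Rightarrow> nat" where
  "min_linkedness _ d \<gamma> =
     Max {k. \<forall>P \<in> (polytope_class d \<gamma> :: 'a set set). k \<le> linkedness P}"

end

theory Submission
  imports Defs
begin

text \<open>Let \<open>V\<close> be the vertex set of a \<open>d\<close>-polytope with \<open>d + \<gamma> + 1\<close> vertices. The affine relations on \<open>V\<close>
  form a space of dimension \<open>\<gamma>\<close>, and every missing edge \<open>{u, v}\<close> carries a relation that is positive exactly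
  at \<open>u\<close> and \<open>v\<close>. Since no non-zero relation has fewer than two positive entries, a linear
  relation between these splits into its positive and its negative part. Hence missing edges at a common vertex give
  independent relations, so each vertex has at most \<open>\<gamma>\<close> non-neighbours; and disjoint missing edges give
  relations of rank at least half their number, so there are at most \<open>2 * \<gamma>\<close> of them, with equality only if
  no vertex has two non-neighbours.

  These two facts suffice to link any \<open>k\<close> pairs that leave \<open>2 * \<gamma>\<close> vertices free, with at most two inner
  vertices per path. The pairs are linked one at a time, and the paths found so far are kept
  as short as possible. If a new pair \<open>s, t\<close> cannot be linked directly, one may arrange that \<open>s\<close> has a free neighbour
  \<open>x\<close> and \<open>t\<close> a free neighbour \<open>y\<close>. Counting the non-neighbours of \<open>s, t, x, y\<close>
  yields a path with so few of them that \<open>x\<close> or \<open>y\<close> can replace one of its inner vertices, and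
  the vertex thus freed links \<open>s\<close> to \<open>t\<close>.

  The bound is attained by an iterated pyramid over the join of \<open>\<gamma>\<close> squares: each
  of the \<open>2 * \<gamma>\<close> diagonals, used as a terminal pair, needs an inner vertex.\<close>

subsection \<open>Affine relations between the vertices\<close>

text \<open>Only the values on \<open>V\<close> matter: relations are compared, and regarded as
  zero, on \<open>V\<close> alone.\<close>

definition affine_relation :: "'a::real_vector set \<Rightarrow> ('a \<Rightarrow> real) \<Rightarrow> bool" where
  "affine_relation V f \<longleftrightarrow> sum f V = 0 \<and> (\<Sum>v\<in>V. f v *\<^sub>R v) = 0"

lemma affine_relation_combination:
  assumes "\<And>b. b \<in> B \<Longrightarrow> affine_relation V (f b)"
  shows "affine_relation V (\<lambda>v. \<Sum>b\<in>B. a b * f b v)"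
proof -
  have "(\<Sum>v\<in>V. \<Sum>b\<in>B. a b * f b v) = (\<Sum>b\<in>B. a b * (\<Sum>v\<in>V. f b v))"
    by (subst sum.swap) (simp add: sum_distrib_left)
  moreover have "(\<Sum>v\<in>V. (\<Sum>b\<in>B. a b * f b v) *\<^sub>R v) = (\<Sum>b\<in>B. a b *\<^sub>R (\<Sum>v\<in>V. f b v *\<^sub>R v))"
    by (simp only: scaleR_sum_left, subst sum.swap) (simp add: scaleR_sum_right)
  ultimately show ?thesis
    using assms by (simp add: affine_relation_def)
qed

lemma affine_relation_nonpos_imp_zero:
  assumes "finite V" "affine_relation V g" "\<And>v. v \<in> V \<Longrightarrow> g v \<le> 0" "v \<in> V"
  shows "g v = 0"
proof -
  have "(\<Sum>v\<in>V. - g v) = 0" using assms(2) by (simp add: affine_relation_def sum_negf)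
  then have "\<forall>v\<in>V. - g v = 0"
    using assms(1,3) by (subst (asm) sum_nonneg_eq_0_iff) auto
  then show ?thesis using assms(4) by simp
qed

text \<open>If \<open>g u\<close> were positive, dividing the other entries by \<open>- g u\<close>
  would write \<open>u\<close> as a convex combination of the remaining points. So on points in
  convex position a non-zero relation has at least two positive entries.\<close>

lemma affine_relation_one_pos_imp_zero:
  assumes fin: "finite V" and rel: "affine_relation V g"
    and u: "u \<in> V" "u \<notin> convex hull (V - {u})"
    and nonpos: "\<And>v. v \<in> V \<Longrightarrow> v \<noteq> u \<Longrightarrow> g v \<le> 0" and v: "v \<in> V"
  shows "g v = 0"
proof (cases "g u \<le> 0")
  case True
  then show ?thesis using affine_relation_nonpos_imp_zero[OF fin rel] nonpos v by metis
next
  case False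
  let ?w = "\<lambda>v. - g v / g u"
  have "sum g V = g u + sum g (V - {u})" "(\<Sum>v\<in>V. g v *\<^sub>R v) = g u *\<^sub>R u + (\<Sum>v\<in>V - {u}. g v *\<^sub>R v)"
    using fin u by (simp_all add: sum.remove)
  then have 1: "sum g (V - {u}) = - g u" and 2: "(\<Sum>v\<in>V - {u}. g v *\<^sub>R v) = - (g u *\<^sub>R u)"
    using rel by (auto simp: affine_relation_def algebra_simps add_eq_0_iff)
  have "sum ?w (V - {u}) = 1"
    using False 1 by (simp add: sum_divide_distrib[symmetric] sum_negf)
  moreover have "(\<Sum>v\<in>V - {u}. ?w v *\<^sub>R v) = (- 1 / g u) *\<^sub>R (\<Sum>v\<in>V - {u}. g v *\<^sub>R v)"
    by (simp add: scaleR_sum_right sum_negf)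
  then have "(\<Sum>v\<in>V - {u}. ?w v *\<^sub>R v) = u"
    using False 2 by simp
  moreover have "\<forall>v\<in>V - {u}. 0 \<le> ?w v"
    using nonpos False by (auto simp: divide_le_0_iff)
  ultimately have "u \<in> convex hull (V - {u})"
    unfolding convex_hull_finite[OF finite_Diff[OF fin]] mem_Collect_eq
    by (intro exI[of _ ?w] conjI)
  with u show ?thesis by simp
qed

section \<open>Linear dependence among relations\<close>

text \<open>Gaussian elimination, by induction on the equations, which are indexed by
  \<open>C\<close>; the unknowns are indexed by \<open>B\<close>.\<close>

lemma nontrivial_solution:
  fixes f :: "'b \<Rightarrow> 'c \<Rightarrow> real"
  assumes "finite C" "finite B" "card C < card B"
  shows "\<exists>a. (\<exists>b\<in>B. a b \<noteq> 0) \<and> (\<forall>c\<in>C. (\<Sum>b\<in>B. a b * f b c) = 0)"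
  using assms
proof (induction C arbitrary: B f)
  case empty
  then have "B \<noteq> {}" by auto
  then show ?case by (intro exI[of _ "\<lambda>_. 1"]) auto
next
  case (insert c C)
  show ?case
  proof (cases "\<forall>b\<in>B. f b c = 0")
    case True
    have "card C < card B" using insert by simp
    then obtain a where "\<exists>b\<in>B. a b \<noteq> 0" "\<forall>c\<in>C. (\<Sum>b\<in>B. a b * f b c) = 0"
      using insert.IH[OF insert.prems(1), of f] by auto
    then show ?thesis using True by (intro exI[of _ a]) auto
  next
    case False
    then obtain b0 where b0: "b0 \<in> B" "f b0 c \<noteq> 0" by auto
    \<comment> \<open>Equation \<open>c\<close> is used to eliminate the unknown \<open>b0\<close>
      from the others; \<open>r\<close> below is the value that then solves \<open>c\<close> for
      this unknown.\<close>
    let ?B = "B - {b0}"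
    have "card C < card ?B" "finite ?B" using insert b0 by auto
    then obtain a where a: "\<exists>b\<in>?B. a b \<noteq> 0"
        "\<forall>x\<in>C. (\<Sum>b\<in>?B. a b * (f b x - f b c / f b0 c * f b0 x)) = 0"
      using insert.IH[of ?B "\<lambda>b x. f b x - f b c / f b0 c * f b0 x"] by auto
    define r where "r = - (\<Sum>b\<in>?B. a b * f b c) / f b0 c"
    let ?a = "a(b0 := r)"
    have S: "(\<Sum>b\<in>B. ?a b * f b x) = r * f b0 x + (\<Sum>b\<in>?B. a b * f b x)" for x
      using b0 insert.prems(1) by (subst sum.remove[of _ b0]) (auto intro!: sum.cong)
    have "(\<Sum>b\<in>B. ?a b * f b c) = 0"
      using b0 by (simp only: S) (simp add: r_def)
    moreover have "(\<Sum>b\<in>B. ?a b * f b x) = 0" if "x \<in> C" for x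
    proof -
      have "(\<Sum>b\<in>?B. a b * (f b x - f b c / f b0 c * f b0 x))
          = (\<Sum>b\<in>?B. a b * f b x) - (\<Sum>b\<in>?B. a b * f b c) * (f b0 x / f b0 c)"
        unfolding sum_distrib_right sum_subtractf[symmetric] by (rule sum.cong) (simp_all add: algebra_simps)
      then show ?thesis
        using a(2) that b0 by (simp only: S) (simp add: r_def)
    qed
    ultimately show ?thesis using a(1) by (intro exI[of _ ?a]) auto
  qed
qed

text \<open>A relation that vanishes off an affine basis \<open>A\<close> of \<open>V\<close> is
  supported on an affinely independent set, hence zero. So a combination has to be made to vanish
  only at the \<open>\<gamma>\<close> points of \<open>V - A\<close>, which are fewer equations than
  unknowns.\<close>

lemma affine_relations_dependent:
  fixes V :: "'a::euclidean_space set"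
  assumes V: "finite V" "aff_dim V = int d" "card V = d + \<gamma> + 1"
    and B: "finite B" "\<gamma> < card B" and rel: "\<And>b. b \<in> B \<Longrightarrow> affine_relation V (f b)"
  shows "\<exists>a. (\<exists>b\<in>B. a b \<noteq> 0) \<and> (\<forall>v\<in>V. (\<Sum>b\<in>B. a b * f b v) = 0)"
proof -
  obtain A where A: "A \<subseteq> V" "\<not> affine_dependent A" "affine hull V = affine hull A"
    using affine_basis_exists by metis
  then have "card A = d + 1"
    using aff_dim_affine_independent[OF A(2)] V(2) by (metis aff_dim_affine_hull of_nat_1 of_nat_add of_nat_eq_iff diff_eq_eq)
  have "finite A" using A(1) V(1) finite_subset by auto
  have "card (V - A) = \<gamma>"
    using V \<open>card A = d + 1\<close> A(1) by (simp add: card_Diff_subset \<open>finite A\<close>)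
  then obtain a where a: "\<exists>b\<in>B. a b \<noteq> 0" "\<forall>v\<in>V - A. (\<Sum>b\<in>B. a b * f b v) = 0"
    using nontrivial_solution[of "V - A" B f] B V(1) by auto
  define g where "g v = (\<Sum>b\<in>B. a b * f b v)" for v
  have g: "affine_relation V g"
    unfolding g_def by (rule affine_relation_combination) (rule rel)
  have "g v = 0" if "v \<in> V" for v
  proof (rule ccontr)
    assume "g v \<noteq> 0"
    then have "v \<in> A" using a(2) that by (auto simp: g_def)
    have "sum g A = sum g V" "(\<Sum>v\<in>A. g v *\<^sub>R v) = (\<Sum>v\<in>V. g v *\<^sub>R v)"
      using a(2) A(1) V(1) by (auto intro!: sum.mono_neutral_left simp: g_def)
    then have "affine_dependent A"
      using g \<open>v \<in> A\<close> \<open>g v \<noteq> 0\<close> \<open>finite A\<close>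
      by (auto simp: affine_relation_def affine_dependent_explicit_finite)
    then show False using A(2) by simp
  qed
  then show ?thesis using a(1) unfolding g_def by (intro exI[of _ a]) simp
qed

text \<open>The positive and the negative part of the zero combination give the same relation
  \<open>g\<close>. At a point other than \<open>u\<close> at most one \<open>f b\<close> is
  positive, and this \<open>b\<close> is absent from one of the two parts, which therefore shows
  \<open>g\<close> to be nonpositive there. Thus only \<open>u\<close> can be a positive entry, and
  \<open>g\<close> vanishes.\<close>

lemma positive_part_relation:
  fixes V :: "'a::euclidean_space set" and c :: "'b \<Rightarrow> real"
  assumes V: "finite V" and u: "u \<in> V" "u \<notin> convex hull (V - {u})"
    and B: "finite B" and rel: "\<And>b. b \<in> B \<Longrightarrow> affine_relation V (f b)"
    and sep: "\<And>b b' v. \<lbrakk>b \<in> B; b' \<in> B; b \<noteq> b'; v \<in> V; v \<noteq> u; 0 < f b v\<rbrakk> \<Longrightarrow> f b' v \<le> 0"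
    and zero: "\<And>v. v \<in> V \<Longrightarrow> (\<Sum>b\<in>B. c b * f b v) = 0" and v: "v \<in> V"
  shows "(\<Sum>b\<in>B. max 0 (c b) * f b v) = 0"
proof -
  define g where "g v = (\<Sum>b\<in>B. max 0 (c b) * f b v)" for v
  have g': "g v = (\<Sum>b\<in>B. max 0 (- c b) * f b v)" if "v \<in> V" for v
  proof -
    have "g v - (\<Sum>b\<in>B. max 0 (- c b) * f b v) = (\<Sum>b\<in>B. c b * f b v)"
      unfolding g_def sum_subtractf[symmetric] by (rule sum.cong) (auto simp: max_def algebra_simps)
    then show ?thesis using zero that by simp
  qed
  have "g v \<le> 0" if "v \<in> V" "v \<noteq> u" for v
  proof (cases "\<exists>b\<in>B. 0 < c b \<and> 0 < f b v")
    case True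
    then obtain b where b: "b \<in> B" "0 < c b" "0 < f b v" by auto
    have "max 0 (- c b') * f b' v \<le> 0" if "b' \<in> B" for b'
      using b sep[of b b' v] that \<open>v \<in> V\<close> \<open>v \<noteq> u\<close> by (cases "b' = b") (auto simp: mult_nonneg_nonpos)
    then show ?thesis using g' that by (simp add: sum_nonpos)
  next
    case False
    then have "max 0 (c b) * f b v \<le> 0" if "b \<in> B" for b
      using that by (cases "0 < c b") (auto simp: mult_nonneg_nonpos not_less)
    then show ?thesis by (simp add: g_def sum_nonpos)
  qed
  moreover have "affine_relation V g"
    unfolding g_def by (rule affine_relation_combination) (rule rel)
  ultimately have "g v = 0" using affine_relation_one_pos_imp_zero[OF V _ u] v by blast
  then show ?thesis by (simp add: g_def)
qed

text \<open>All \<open>f b\<close> are positive at \<open>u\<close>, so the positive part of a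
  vanishing combination can be zero at \<open>u\<close> only if it has no positive coefficient.
  Applied to a dependence and to its negative, this makes all coefficients zero.\<close>

lemma card_star_le:
  fixes V :: "'a::euclidean_space set"
  assumes V: "finite V" "aff_dim V = int d" "card V = d + \<gamma> + 1"
    and u: "u \<in> V" "u \<notin> convex hull (V - {u})"
    and B: "B \<subseteq> V - {u}" and rel: "\<And>b. b \<in> B \<Longrightarrow> affine_relation V (f b)"
    and pos: "\<And>b v. b \<in> B \<Longrightarrow> v \<in> V \<Longrightarrow> 0 < f b v \<longleftrightarrow> v = u \<or> v = b"
  shows "card B \<le> \<gamma>"
proof (rule ccontr)
  assume "\<not> card B \<le> \<gamma>"
  moreover have fB: "finite B" using B V(1) finite_subset by blast
  ultimately have "\<exists>a. (\<exists>b\<in>B. a b \<noteq> 0) \<and> (\<forall>v\<in>V. (\<Sum>b\<in>B. a b * f b v) = 0)"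
    using rel by (intro affine_relations_dependent[OF V]) simp_all
  then obtain a where a: "\<exists>b\<in>B. a b \<noteq> 0" "\<And>v. v \<in> V \<Longrightarrow> (\<Sum>b\<in>B. a b * f b v) = 0"
    by metis
  have nonpos: "c b \<le> 0" if "\<And>v. v \<in> V \<Longrightarrow> (\<Sum>b\<in>B. c b * f b v) = 0" "b \<in> B" for c b
  proof -
    have "(\<Sum>b\<in>B. max 0 (c b) * f b u) = 0"
      using that(1) by (intro positive_part_relation[OF V(1) u fB rel _ _ u(1)]) (auto simp: pos not_less[symmetric])
    moreover have "0 \<le> max 0 (c b) * f b u" "0 < f b u" if "b \<in> B" for b
      using pos[OF that u(1)] by auto
    ultimately have "max 0 (c b) * f b u = 0"
      using fB that(2) by (simp add: sum_nonneg_eq_0_iff)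
    with \<open>b \<in> B \<Longrightarrow> 0 < f b u\<close> that(2) show ?thesis by (auto simp: max_def split: if_splits)
  qed
  have "a b \<le> 0" "- a b \<le> 0" if "b \<in> B" for b
    using nonpos[of a b] nonpos[of "\<lambda>b. - a b" b] a(2) that by (auto simp: sum_negf)
  then show False using a(1) by (metis antisym neg_le_0_iff_le)
qed

section \<open>Relations carried by missing edges, and disjoint missing edges\<close>

text \<open>Since the segment is not a face, the line through \<open>u\<close> and \<open>v\<close>
  meets the hull of the other points in some \<open>p\<close>. Subtracting the two expressions for
  \<open>p\<close> gives the relation.\<close>

lemma non_edge_relation:
  fixes V :: "'a::euclidean_space set"
  assumes V: "finite V" and ext: "\<And>v. v \<in> V \<Longrightarrow> v \<notin> convex hull (V - {v})"
    and uv: "u \<in> V" "v \<in> V" "u \<noteq> v" and no: "\<not> closed_segment u v edge_of (convex hull V)"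
  obtains f where "affine_relation V f" "\<And>w. w \<in> V \<Longrightarrow> 0 < f w \<longleftrightarrow> w = u \<or> w = v"
proof -
  let ?C = "V - {u, v}"
  have "\<not> closed_segment u v face_of (convex hull V)"
    using no uv by (simp add: edge_of_def segment_convex_hull aff_dim_convex_hull aff_dim_2)
  then have "affine hull {u, v} \<inter> convex hull ?C \<noteq> {}"
    using face_of_convex_hulls[OF V, of "{u, v}"] uv by (auto simp: segment_convex_hull)
  then obtain p where p: "p \<in> affine hull {u, v}" "p \<in> convex hull ?C" by blast
  then obtain a b where ab: "p = a *\<^sub>R u + b *\<^sub>R v" "a + b = 1"
    by (auto simp: affine_hull_2)
  \<comment> \<open>A nonpositive \<open>y\<close> would put \<open>x'\<close> on the segment from
    \<open>p\<close> to \<open>y'\<close>, inside the hull of the other points. Used in both orders,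
    this places \<open>p\<close> strictly between \<open>u\<close> and \<open>v\<close>.\<close>
  have pos: "0 < y" if xy: "x' \<in> V" "y' \<in> V" "x' \<noteq> y'" "?C \<subseteq> V - {x', y'}" "p = x *\<^sub>R x' + y *\<^sub>R y'" "x + y = 1"
    for x y x' y'
  proof (rule ccontr)
    assume "\<not> 0 < y"
    then have x: "1 \<le> x" using xy by simp
    have "x' = (1 / x) *\<^sub>R (x *\<^sub>R x')" using x by simp
    also have "x *\<^sub>R x' = p + (x - 1) *\<^sub>R y'"
      using xy(5) xy(6) by (simp add: algebra_simps eq_diff_eq flip: scaleR_add_left)
    finally have "x' = (1 / x) *\<^sub>R p + (1 - 1 / x) *\<^sub>R y'"
      using x by (simp add: algebra_simps diff_divide_distrib)
    moreover have "p \<in> convex hull (V - {x'})"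
      using p(2) hull_mono[of ?C "V - {x'}"] xy(4) by blast
    moreover have "y' \<in> convex hull (V - {x'})" using xy by (simp add: hull_inc)
    ultimately have "x' \<in> convex hull (V - {x'})"
      using x convexD[OF convex_convex_hull, of p _ y' "1 / x" "1 - 1 / x"] by simp
    then show False using ext xy(1) by blast
  qed
  have "0 < b" using pos[of u v a b] uv ab by auto
  have "0 < a" using pos[of v u b a] uv ab by (auto simp: add.commute)
  obtain w where w: "\<And>x. x \<in> ?C \<Longrightarrow> 0 \<le> w x" "sum w ?C = 1" "(\<Sum>x\<in>?C. w x *\<^sub>R x) = p"
    using p(2) V by (auto simp: convex_hull_finite)
  define f where "f x = (if x = u then a else if x = v then b else - w x)" for x
  have split: "sum h V = h u + h v + sum h ?C" for h :: "'a \<Rightarrow> 'c::ab_group_add"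
  proof -
    have "sum h V = h u + sum h (V - {u})" using V uv by (simp add: sum.remove)
    also have "sum h (V - {u}) = h v + sum h (V - {u} - {v})" using V uv by (subst sum.remove[of _ v]) auto
    also have "V - {u} - {v} = ?C" by auto
    finally show ?thesis by (simp add: add.assoc)
  qed
  have "sum f ?C = (\<Sum>x\<in>?C. - w x)" "(\<Sum>x\<in>?C. f x *\<^sub>R x) = (\<Sum>x\<in>?C. - (w x *\<^sub>R x))"
    by (intro sum.cong; simp add: f_def)+
  then have C: "sum f ?C = - 1" "(\<Sum>x\<in>?C. f x *\<^sub>R x) = - p"
    using w(2,3) by (simp_all add: sum_negf)
  have "affine_relation V f"
    unfolding affine_relation_def split C using ab uv by (simp add: f_def)
  moreover have "0 < f x \<longleftrightarrow> x = u \<or> x = v" if "x \<in> V" for x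
    using w(1)[of x] that \<open>0 < a\<close> \<open>0 < b\<close> by (auto simp: f_def not_less[symmetric])
  ultimately show thesis using that by blast
qed

text \<open>\<open>B\<close> is a maximal subset of \<open>M\<close> with independent relations.
  Every other \<open>f e\<close> is minus a nonnegative combination of those in \<open>B\<close>,
  and no \<open>b\<close> occurs in two of these combinations; picking for each \<open>e\<close> one
  \<open>b\<close> that occurs defines \<open>h\<close>. If \<open>h\<close> is onto, each
  combination has a single term.\<close>

lemma positive_pairs_basis:
  fixes V :: "'a::euclidean_space set"
  assumes V: "finite V" "aff_dim V = int d" "card V = d + \<gamma> + 1"
    and ext: "\<And>v. v \<in> V \<Longrightarrow> v \<notin> convex hull (V - {v})"
    and M: "pairwise disjnt M" "\<And>e. e \<in> M \<Longrightarrow> e \<subseteq> V \<and> card e = 2"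
    and rel: "\<And>e. e \<in> M \<Longrightarrow> affine_relation V (f e)"
    and pos: "\<And>e v. e \<in> M \<Longrightarrow> v \<in> V \<Longrightarrow> 0 < f e v \<longleftrightarrow> v \<in> e"
  obtains B h where "B \<subseteq> M" "finite M" "card B \<le> \<gamma>" "inj_on h (M - B)" "h ` (M - B) \<subseteq> B"
    "\<forall>a. (\<forall>v\<in>V. (\<Sum>e\<in>B. a e * f e v) = 0) \<longrightarrow> (\<forall>e\<in>B. a e = 0)"
    "h ` (M - B) = B \<longrightarrow> (\<forall>b\<in>B. \<exists>e\<in>M - B. \<exists>r>0. \<forall>x\<in>V. f e x = - r * f b x)"
proof -
  obtain x0 where x0: "x0 \<in> V" using V by fastforce
  have finM: "finite M" using M(2) V(1) by (intro finite_subset[of M "Pow V"]) auto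
  have disj: "e = e'" if "e \<in> M" "e' \<in> M" "x \<in> e" "x \<in> e'" for e e' x
    using M(1) that by (auto simp: pairwise_def disjnt_def)
  have inV: "x \<in> V" if "e \<in> M" "x \<in> e" for e x using M(2) that by blast
  define indep where "indep B \<longleftrightarrow>
    (\<forall>a. (\<forall>v\<in>V. (\<Sum>e\<in>B. a e * f e v) = 0) \<longrightarrow> (\<forall>e\<in>B. a e = 0))" for B
  define S where "S = {B. B \<subseteq> M \<and> indep B}"
  have "finite S" "{} \<in> S"
    using finM by (simp_all add: S_def indep_def)
  then obtain B where "B \<in> S" and max: "\<And>B'. B' \<in> S \<Longrightarrow> B \<subseteq> B' \<Longrightarrow> B = B'"
    using finite_has_maximal[of S] by (metis empty_iff)
  then have B: "B \<subseteq> M" "indep B" by (simp_all add: S_def)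
  have finB: "finite B" using B(1) finM finite_subset by blast
  have indepD: "a e = 0" if "\<And>v. v \<in> V \<Longrightarrow> (\<Sum>e\<in>B. a e * f e v) = 0" "e \<in> B" for a e
    using B(2) that by (auto simp: indep_def)
  have cardB: "card B \<le> \<gamma>"
  proof (rule ccontr)
    assume "\<not> card B \<le> \<gamma>"
    then have "\<exists>a. (\<exists>b\<in>B. a b \<noteq> 0) \<and> (\<forall>v\<in>V. (\<Sum>b\<in>B. a b * f b v) = 0)"
      using rel B(1) by (intro affine_relations_dependent[OF V finB]) auto
    then show False using B(2) by (auto simp: indep_def)
  qed
  \<comment> \<open>Disjoint pairs have no common positive vertex, so any vertex \<open>x0\<close>
    can serve as the exceptional one.\<close>
  have ppart: "(\<Sum>e\<in>N. max 0 (c e) * f e v) = 0"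
    if "N \<subseteq> M" "\<And>v. v \<in> V \<Longrightarrow> (\<Sum>e\<in>N. c e * f e v) = 0" "v \<in> V" for N c v
  proof (rule positive_part_relation[OF V(1) x0 ext[OF x0] _ _ _ that(2,3)])
    show "finite N" using that(1) finM finite_subset by blast
    show "affine_relation V (f e)" if "e \<in> N" for e using that \<open>N \<subseteq> M\<close> rel by blast
    show "f e' v \<le> 0" if "e \<in> N" "e' \<in> N" "e \<noteq> e'" "v \<in> V" "0 < f e v" for e e' v
      using that \<open>N \<subseteq> M\<close> pos[of e v] pos[of e' v] disj[of e e' v] by (auto simp: not_less[symmetric])
  qed
  have "\<exists>w. (\<forall>b. 0 \<le> w b) \<and> (\<forall>v\<in>V. f e v + (\<Sum>b\<in>B. w b * f b v) = 0)" if e: "e \<in> M - B" for e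
  proof -
    have "\<not> indep (insert e B)" using max[of "insert e B"] B(1) e by (auto simp: S_def)
    then obtain a where a: "\<And>v. v \<in> V \<Longrightarrow> a e * f e v + (\<Sum>b\<in>B. a b * f b v) = 0"
        "\<exists>b\<in>insert e B. a b \<noteq> 0"
      using e finB by (auto simp: indep_def)
    have "a e \<noteq> 0" using a indepD[of a] by auto
    \<comment> \<open>Division by \<open>a e\<close> gives \<open>e\<close> the coefficient 1, which
      survives in the positive part; the other coefficients of that part become the weights
      \<open>w e\<close>.\<close>
    define c where "c b = a b / a e" for b
    have c: "(\<Sum>b\<in>insert e B. c b * f b v) = 0" if "v \<in> V" for v
    proof -
      have "(\<Sum>b\<in>insert e B. c b * f b v) = (a e * f e v + (\<Sum>b\<in>B. a b * f b v)) / a e"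
        using e finB by (simp add: c_def sum_divide_distrib add_divide_distrib)
      then show ?thesis using a(1) that by simp
    qed
    have "(\<Sum>b\<in>insert e B. max 0 (c b) * f b v) = 0" if "v \<in> V" for v
      using ppart[OF _ c that] e B(1) by blast
    moreover have "c e = 1" using \<open>a e \<noteq> 0\<close> by (simp add: c_def)
    ultimately show ?thesis
      using e finB by (intro exI[of _ "\<lambda>b. max 0 (c b)"]) auto
  qed
  then obtain w where w0: "\<And>e b. e \<in> M - B \<Longrightarrow> 0 \<le> w e b"
    and w: "\<And>e v. e \<in> M - B \<Longrightarrow> v \<in> V \<Longrightarrow> f e v + (\<Sum>b\<in>B. w e b * f b v) = 0"
    by metis
  have uniq: "e = e'" if e: "e \<in> M - B" "e' \<in> M - B" and b: "b \<in> B" "0 < w e b" "0 < w e' b" for e e' b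
  proof (rule ccontr)
    assume "e \<noteq> e'"
    \<comment> \<open>With this \<open>r\<close>, the relation for \<open>e\<close> minus
      \<open>r\<close> times the one for \<open>e'\<close> no longer contains \<open>b\<close>. Its
      positive part loses \<open>e'\<close> too, whose coefficient is \<open>- r\<close>, and so
      expresses \<open>f e\<close> through \<open>B\<close> without \<open>b\<close>; independence
      then contradicts \<open>0 < w e b\<close>.\<close>
    define r where "r = w e b / w e' b"
    have "0 < r" using b by (simp add: r_def)
    define c where "c x = (if x = e then 1 else if x = e' then - r else w e x - r * w e' x)" for x
    have split: "(\<Sum>x\<in>insert e (insert e' B). h (c x) * f x v)
        = h 1 * f e v + h (- r) * f e' v + (\<Sum>x\<in>B. h (w e x - r * w e' x) * f x v)" for h v
    proof -
      have "(\<Sum>x\<in>B. h (c x) * f x v) = (\<Sum>x\<in>B. h (w e x - r * w e' x) * f x v)"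
        using e by (intro sum.cong) (auto simp: c_def)
      then show ?thesis using e \<open>e \<noteq> e'\<close> finB by (simp add: c_def)
    qed
    have "(\<Sum>x\<in>insert e (insert e' B). c x * f x v) = 0" if "v \<in> V" for v
    proof -
      have "(\<Sum>x\<in>insert e (insert e' B). c x * f x v)
          = (f e v + (\<Sum>b\<in>B. w e b * f b v)) - r * (f e' v + (\<Sum>b\<in>B. w e' b * f b v))"
        using split[of "\<lambda>x. x" v]
        by (simp add: algebra_simps sum_subtractf sum_distrib_left)
      then show ?thesis using w e that by simp
    qed
    then have "(\<Sum>x\<in>insert e (insert e' B). max 0 (c x) * f x v) = 0" if "v \<in> V" for v
      using ppart[of "insert e (insert e' B)" c v] e B(1) that by blast
    then have "f e v + (\<Sum>x\<in>B. max 0 (w e x - r * w e' x) * f x v) = 0" if "v \<in> V" for v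
      using split[of "max 0" v] that \<open>0 < r\<close> by simp
    then have "(\<Sum>x\<in>B. w e x * f x v) = (\<Sum>x\<in>B. max 0 (w e x - r * w e' x) * f x v)" if "v \<in> V" for v
      using w[OF e(1) that] that by (metis add_left_cancel)
    then have "(\<Sum>x\<in>B. (w e x - max 0 (w e x - r * w e' x)) * f x v) = 0" if "v \<in> V" for v
      using that by (simp only: left_diff_distrib sum_subtractf)
    then have "w e b - max 0 (w e b - r * w e' b) = 0"
      by (rule indepD[of "\<lambda>x. w e x - max 0 (w e x - r * w e' x)", OF _ b(1)])
    then show False using b by (simp add: r_def)
  qed
  have ex: "\<exists>b\<in>B. 0 < w e b" if e: "e \<in> M - B" for e
  proof (rule ccontr)
    assume "\<not> (\<exists>b\<in>B. 0 < w e b)"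
    then have "w e b = 0" if "b \<in> B" for b using w0[OF e, of b] that by fastforce
    moreover obtain x where "x \<in> e" using M(2)[of e] e by fastforce
    ultimately have "f e x = 0" using w[OF e, of x] inV[of e x] e by simp
    then show False using pos[of e x] inV[of e x] e \<open>x \<in> e\<close> by simp
  qed
  then obtain h where h: "\<And>e. e \<in> M - B \<Longrightarrow> h e \<in> B \<and> 0 < w e (h e)" by metis
  have inj: "inj_on h (M - B)"
  proof (rule inj_onI)
    fix e e' assume "e \<in> M - B" "e' \<in> M - B" "h e = h e'"
    then show "e = e'" using uniq[of e e' "h e"] h[of e] h[of e'] by simp
  qed
  have opp: "\<exists>e\<in>M - B. \<exists>r>0. \<forall>x\<in>V. f e x = - r * f b x" if surj: "h ` (M - B) = B" and "b \<in> B" for b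
  proof -
    have onto: "\<exists>e\<in>M - B. h e = x" if "x \<in> B" for x
    proof -
      have "x \<in> h ` (M - B)" using that surj by simp
      then show ?thesis by auto
    qed
    obtain e where e: "e \<in> M - B" "h e = b" using onto[OF \<open>b \<in> B\<close>] by auto
    \<comment> \<open>Such an \<open>x\<close> already occurs in the combination of the pair that
      \<open>h\<close> maps to it, and that pair is not \<open>e\<close>.\<close>
    have "w e x = 0" if x: "x \<in> B" "x \<noteq> b" for x
    proof (rule ccontr)
      assume "w e x \<noteq> 0"
      obtain e' where e': "e' \<in> M - B" "h e' = x" using onto[OF x(1)] by auto
      then have "e = e'"
        using uniq[OF e(1) e'(1) x(1)] h[OF e'(1)] w0[OF e(1), of x] \<open>w e x \<noteq> 0\<close> by simp
      then show False using e e' x by simp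
    qed
    then have "(\<Sum>x\<in>B. w e x * f x y) = w e b * f b y" for y
      using finB \<open>b \<in> B\<close> by (simp add: sum.remove[of B b])
    then have "\<forall>x\<in>V. f e x = - w e b * f b x"
      using w[OF e(1)] by (simp add: eq_neg_iff_add_eq_0)
    then show ?thesis using h[OF e(1)] e by blast
  qed
  have hB: "h ` (M - B) \<subseteq> B" using h by auto
  show thesis
    using B(2) opp by (intro that[OF B(1) finM cardB inj hB]) (auto simp: indep_def)
qed

text \<open>The bound counts \<open>M - B\<close> by its injection into \<open>B\<close>. If it is
  attained, \<open>B\<close> spans all relations on \<open>V\<close>, and each \<open>f b\<close> is
  positive on \<open>b\<close>, negative on an opposite pair \<open>o' b\<close> in
  \<open>M - B\<close> and zero elsewhere. These supports are disjoint, so \<open>g\<close>, a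
  combination of the \<open>f b\<close>, is positive on some whole pair of \<open>M\<close>, which
  can only be \<open>{u, v}\<close>.\<close>

lemma matching_of_positive_pairs:
  fixes V :: "'a::euclidean_space set"
  assumes V: "finite V" "aff_dim V = int d" "card V = d + \<gamma> + 1"
    and ext: "\<And>v. v \<in> V \<Longrightarrow> v \<notin> convex hull (V - {v})"
    and M: "pairwise disjnt M" "\<And>e. e \<in> M \<Longrightarrow> e \<subseteq> V \<and> card e = 2"
    and rel: "\<And>e. e \<in> M \<Longrightarrow> affine_relation V (f e)"
    and pos: "\<And>e v. e \<in> M \<Longrightarrow> v \<in> V \<Longrightarrow> 0 < f e v \<longleftrightarrow> v \<in> e"
  shows "card M \<le> 2 * \<gamma>"
    and "\<lbrakk>card M = 2 * \<gamma>; affine_relation V g; \<And>w. w \<in> V \<Longrightarrow> 0 < g w \<longleftrightarrow> w = u \<or> w = v;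
          u \<in> V; v \<in> V; u \<noteq> v\<rbrakk> \<Longrightarrow> {u, v} \<in> M"
proof -
  obtain B h where B: "B \<subseteq> M" and finM: "finite M" and cardB: "card B \<le> \<gamma>"
    and inj: "inj_on h (M - B)" and hB: "h ` (M - B) \<subseteq> B"
    and indep: "\<forall>a. (\<forall>v\<in>V. (\<Sum>e\<in>B. a e * f e v) = 0) \<longrightarrow> (\<forall>e\<in>B. a e = 0)"
    and opp: "h ` (M - B) = B \<longrightarrow> (\<forall>b\<in>B. \<exists>e\<in>M - B. \<exists>r>0. \<forall>x\<in>V. f e x = - r * f b x)"
    by (rule positive_pairs_basis[OF V ext M rel pos])
  have finB: "finite B" using B finM finite_subset by blast
  have disj: "e = e'" if "e \<in> M" "e' \<in> M" "x \<in> e" "x \<in> e'" for e e' x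
    using M(1) that by (auto simp: pairwise_def disjnt_def)
  have inV: "x \<in> V" if "e \<in> M" "x \<in> e" for e x using M(2) that by blast
  have cardMB: "card (M - B) \<le> card B"
    using card_inj_on_le[OF inj hB finB] .
  have cardM: "card M = card B + card (M - B)"
    using B finM finB by (simp add: card_Diff_subset card_mono)
  show "card M \<le> 2 * \<gamma>" using cardMB cardB cardM by simp
  show "{u, v} \<in> M" if eq: "card M = 2 * \<gamma>" and g: "affine_relation V g"
    and gpos: "\<And>w. w \<in> V \<Longrightarrow> 0 < g w \<longleftrightarrow> w = u \<or> w = v" and uv: "u \<in> V" "v \<in> V" "u \<noteq> v"
  proof -
    have "card B = \<gamma>" "card (M - B) = card B" using cardMB cardB cardM eq by auto
    then have surj: "h ` (M - B) = B"
      using card_subset_eq[OF finB hB] card_image[OF inj] by simp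
    obtain o' where o': "\<And>b. b \<in> B \<Longrightarrow> o' b \<in> M - B"
        "\<And>b. b \<in> B \<Longrightarrow> \<exists>r>0. \<forall>x\<in>V. f (o' b) x = - r * f b x"
      using opp surj by metis
    have neg: "f b x < 0 \<longleftrightarrow> x \<in> o' b" if "b \<in> B" "x \<in> V" for b x
      using o'(2)[OF that(1)] that pos[of "o' b" x] o'(1)[OF that(1)]
      by (auto simp: zero_less_mult_iff mult_less_0_iff)
    \<comment> \<open>A common opposite would make \<open>f b\<close> and \<open>f b'\<close>
      positive multiples of each other, so \<open>b\<close> and \<open>b'\<close> would
      meet.\<close>
    have o'_inj: "b = b'" if "b \<in> B" "b' \<in> B" "x \<in> V" "x \<in> o' b" "x \<in> o' b'" for b b' x
    proof (rule ccontr)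
      assume "b \<noteq> b'"
      have "o' b = o' b'" using disj o'(1) that by blast
      moreover obtain y where y: "y \<in> b" using M(2)[of b] B \<open>b \<in> B\<close> by fastforce
      moreover have "y \<in> V" using inV y B that by blast
      moreover obtain r where "r > 0" "\<forall>x\<in>V. f (o' b) x = - r * f b x" using o'(2)[OF \<open>b \<in> B\<close>] by blast
      moreover obtain r' where "r' > 0" "\<forall>x\<in>V. f (o' b') x = - r' * f b' x" using o'(2)[OF \<open>b' \<in> B\<close>] by blast
      ultimately have "r * f b y = r' * f b' y" by (metis minus_equation_iff mult_minus_left)
      moreover have "0 < f b y" using pos y \<open>y \<in> V\<close> B that by blast
      ultimately have "0 < f b' y" using \<open>r > 0\<close> \<open>r' > 0\<close> by (metis zero_less_mult_pos zero_less_mult_iff)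
      then have "y \<in> b'" using pos \<open>y \<in> V\<close> B that by blast
      then show False using disj y B that \<open>b \<noteq> b'\<close> by blast
    qed
    \<comment> \<open>\<open>None\<close> stands for \<open>g\<close> and \<open>Some b\<close> for
      \<open>f b\<close>: one family of \<open>\<gamma> + 1\<close> relations, hence
      dependent.\<close>
    define F where "F i = (case i of None \<Rightarrow> g | Some b \<Rightarrow> f b)" for i
    have "affine_relation V (F i)" if "i \<in> insert None (Some ` B)" for i
      using that g rel B by (auto simp: F_def)
    moreover have "\<gamma> < card (insert None (Some ` B))"
      using finB \<open>card B = \<gamma>\<close> by (simp add: card_image)
    ultimately have "\<exists>a. (\<exists>i\<in>insert None (Some ` B). a i \<noteq> 0) \<and>
        (\<forall>x\<in>V. (\<Sum>i\<in>insert None (Some ` B). a i * F i x) = 0)"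
      using finB by (intro affine_relations_dependent[OF V]) simp_all
    then obtain a where a: "\<exists>i\<in>insert None (Some ` B). a i \<noteq> 0"
        "\<And>x. x \<in> V \<Longrightarrow> (\<Sum>i\<in>insert None (Some ` B). a i * F i x) = 0"
      by metis
    have a': "a None * g x + (\<Sum>b\<in>B. a (Some b) * f b x) = 0" if "x \<in> V" for x
      using a(2)[OF that] finB by (simp add: F_def sum.reindex)
    have "a None \<noteq> 0"
    proof
      assume "a None = 0"
      then have "\<forall>b\<in>B. a (Some b) = 0"
        using a' indep[rule_format, of "\<lambda>b. a (Some b)"] by simp
      with \<open>a None = 0\<close> a(1) show False by simp
    qed
    define c where "c b = - a (Some b) / a None" for b
    have gc: "g x = (\<Sum>b\<in>B. c b * f b x)" if "x \<in> V" for x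
    proof -
      have "(\<Sum>b\<in>B. c b * f b x) = - (\<Sum>b\<in>B. a (Some b) * f b x) / a None"
        by (simp add: c_def sum_divide_distrib sum_negf)
      then show ?thesis using a'[OF that] \<open>a None \<noteq> 0\<close> by (simp add: field_simps add_eq_0_iff)
    qed
    have single: "g x = c b * f b x" if "b \<in> B" "x \<in> V" "x \<in> b \<or> x \<in> o' b" for b x
    proof -
      have "f b' x = 0" if "b' \<in> B" "b' \<noteq> b" for b'
      proof -
        have "x \<notin> b'" "x \<notin> o' b'"
          using disj[of b b' x] disj[of b "o' b'" x] disj[of b' "o' b" x] o'_inj[of b b' x] o'(1)[of b] o'(1)[of b']
            B that \<open>b \<in> B\<close> \<open>x \<in> V\<close> \<open>x \<in> b \<or> x \<in> o' b\<close> by blast+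
        then show ?thesis using pos[of b' x] neg[of b' x] B that \<open>x \<in> V\<close> by fastforce
      qed
      then show ?thesis using gc[OF \<open>x \<in> V\<close>] finB \<open>b \<in> B\<close> by (subst (asm) sum.remove[of _ b]) auto
    qed
    have "\<exists>b\<in>B. c b \<noteq> 0"
    proof (rule ccontr)
      assume "\<not> (\<exists>b\<in>B. c b \<noteq> 0)"
      then have "g u = 0" using gc uv by simp
      then show False using gpos uv by fastforce
    qed
    then obtain b where b: "b \<in> B" "c b \<noteq> 0" by blast
    have eqM: "{u, v} \<in> M" if "e \<in> M" "\<And>x. x \<in> e \<Longrightarrow> 0 < g x" for e
    proof -
      have "e \<subseteq> {u, v}" using that gpos inV by blast
      then have "e = {u, v}" using M(2)[OF that(1)] uv by (metis card_2_iff card_subset_eq finite.intros)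
      then show ?thesis using that by simp
    qed
    show ?thesis
    proof (cases "0 < c b")
      case True
      have "0 < g x" if "x \<in> b" for x
        using single[of b x] pos[of b x] inV[of b x] that b B True by auto
      then show ?thesis using eqM b B by blast
    next
      case False
      have "0 < g x" if "x \<in> o' b" for x
        using single[of b x] neg[of b x] inV[of "o' b" x] o'(1)[of b] that b False
        by (auto simp: zero_less_mult_iff)
      then show ?thesis using eqM o'(1) b by blast
    qed
  qed
qed

subsection \<open>Linking in graphs with few non-adjacent pairs\<close>

text \<open>These are the matchings of the complement graph.\<close>

definition nonadj_matching :: "'v set \<Rightarrow> ('v \<Rightarrow> 'v \<Rightarrow> bool) \<Rightarrow> 'v set set \<Rightarrow> bool" where
  "nonadj_matching V adj M \<longleftrightarrow>
     pairwise disjnt M \<and> (\<forall>e\<in>M. \<exists>u\<in>V. \<exists>v\<in>V. u \<noteq> v \<and> \<not> adj u v \<and> e = {u, v})"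

text \<open>The three bounds are those that affine relations yield for polytope graphs;
  \<open>large_matching\<close> is the equality case of \<open>matching\<close>. \<open>K\<close>
  indexes the terminal pairs, and \<open>W\<close> supplies the inner vertices of the paths.\<close>

locale linking =
  fixes V :: "'v set" and adj :: "'v \<Rightarrow> 'v \<Rightarrow> bool" and \<gamma> :: nat
    and K :: "'i set" and s t :: "'i \<Rightarrow> 'v" and W :: "'v set"
  assumes finV: "finite V" and finK: "finite K"
    and sym: "adj u v \<Longrightarrow> adj v u"
    and degree: "v \<in> V \<Longrightarrow> card {u \<in> V. u \<noteq> v \<and> \<not> adj v u} \<le> \<gamma>"
    and matching: "nonadj_matching V adj M \<Longrightarrow> card M \<le> 2 * \<gamma>"
    and large_matching: "\<lbrakk>nonadj_matching V adj M; card M = 2 * \<gamma>; v \<in> V\<rbrakk>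
      \<Longrightarrow> card {u \<in> V. u \<noteq> v \<and> \<not> adj v u} \<le> 1"
    and W: "W \<subseteq> V" "2 * \<gamma> \<le> card W"
    and terminals: "s ` K \<subseteq> V - W" "t ` K \<subseteq> V - W" "inj_on s K" "inj_on t K" "s ` K \<inter> t ` K = {}"
begin

section \<open>Minimal linkages by short paths\<close>

text \<open>\<open>q\<close> lists the inner vertices only, so the empty list stands for a direct
  edge.\<close>

definition linker :: "'i \<Rightarrow> 'v list \<Rightarrow> bool" where
  "linker i q \<longleftrightarrow> set q \<subseteq> W \<and> distinct q \<and> length q \<le> 2 \<and> successively adj (s i # q @ [t i])"

definition linkage :: "'i set \<Rightarrow> ('i \<Rightarrow> 'v list) \<Rightarrow> bool" where
  "linkage J q \<longleftrightarrow> (\<forall>i\<in>J. linker i (q i)) \<and> disjoint_family_on (\<lambda>i. set (q i)) J"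

definition free :: "'i set \<Rightarrow> ('i \<Rightarrow> 'v list) \<Rightarrow> 'v set" where
  "free J q = W - (\<Union>i\<in>J. set (q i))"

definition total :: "'i set \<Rightarrow> ('i \<Rightarrow> 'v list) \<Rightarrow> nat" where
  "total J q = (\<Sum>i\<in>J. length (q i))"

definition minimal :: "'i set \<Rightarrow> ('i \<Rightarrow> 'v list) \<Rightarrow> bool" where
  "minimal J q \<longleftrightarrow> linkage J q \<and> (\<forall>q'. linkage J q' \<longrightarrow> total J q \<le> total J q')"

definition on_path :: "('i \<Rightarrow> 'v list) \<Rightarrow> 'i \<Rightarrow> 'v set" where
  "on_path q i = {s i, t i} \<union> set (q i)"

text \<open>It is applied to vertices \<open>v\<close> off the path, so that \<open>v\<close> itself
  is never counted.\<close>

definition miss :: "('i \<Rightarrow> 'v list) \<Rightarrow> 'i \<Rightarrow> 'v \<Rightarrow> 'v set" where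
  "miss q i v = {u \<in> on_path q i. \<not> adj v u}"

lemma finW: "finite W"
  using finV W(1) finite_subset by blast

lemma terminal:
  assumes "i \<in> K"
  shows "s i \<in> V" "t i \<in> V" "s i \<notin> W" "t i \<notin> W"
  using terminals(1,2) assms by auto

lemma terminal_neq:
  assumes "i \<in> K" "j \<in> K"
  shows "s i \<noteq> t j" "s i = s j \<longleftrightarrow> i = j" "t i = t j \<longleftrightarrow> i = j"
proof -
  show "s i \<noteq> t j" using terminals(5) assms by (metis disjoint_iff imageI)
  show "s i = s j \<longleftrightarrow> i = j" "t i = t j \<longleftrightarrow> i = j"
    using terminals(3,4) assms by (simp_all add: inj_on_eq_iff)
qed

lemma finite_free: "finite (free J q)"
  using finW by (simp add: free_def)

lemma finite_miss: "finite (miss q i v)"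
  by (simp add: miss_def on_path_def)

lemma adj_commute: "adj u v \<longleftrightarrow> adj v u"
  using sym by blast

lemma linker_simps:
  "linker i [] \<longleftrightarrow> adj (s i) (t i)"
  "linker i [x] \<longleftrightarrow> x \<in> W \<and> adj (s i) x \<and> adj x (t i)"
  "linker i [x, y] \<longleftrightarrow> x \<in> W \<and> y \<in> W \<and> x \<noteq> y \<and> adj (s i) x \<and> adj x y \<and> adj y (t i)"
  by (auto simp: linker_def)

lemma linker_cases:
  assumes "linker i q"
  obtains "q = []" | x where "q = [x]" | x y where "q = [x, y]"
  using assms by (cases q; cases "tl q"; cases "tl (tl q)") (auto simp: linker_def)

lemma linker_if_linkage: "linkage J q \<Longrightarrow> i \<in> J \<Longrightarrow> linker i (q i)"
  by (simp add: linkage_def)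

lemma minimal_imp_linkage: "minimal J q \<Longrightarrow> linkage J q"
  by (simp add: minimal_def)

text \<open>Serves both to reroute an old path and to add a new one; \<open>J - {i}\<close> lets a
  rerouted path reuse its own inner vertices.\<close>

lemma linkage_update:
  assumes "linkage J q" "linker i p" "set p \<subseteq> free (J - {i}) q"
  shows "linkage (insert i J) (q(i := p))"
  using assms by (auto simp: linkage_def disjoint_family_on_def free_def)

lemma free_remove:
  assumes "linkage J q" "i \<in> J"
  shows "free (J - {i}) q = free J q \<union> set (q i)"
proof -
  have "set (q i) \<subseteq> W" using assms by (simp add: linkage_def linker_def)
  moreover have "set (q i) \<inter> set (q j) = {}" if "j \<in> J" "j \<noteq> i" for j
    using assms that by (simp add: linkage_def disjoint_family_on_def)
  ultimately show ?thesis
    using assms(2) by (fastforce simp: free_def)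
qed

lemma total_update:
  assumes "finite J" "i \<in> J"
  shows "total J (q(i := p)) + length (q i) = total J q + length p"
  using assms by (simp add: total_def sum.remove[of J i])

lemma card_free:
  assumes "finite J" "linkage J q"
  shows "card (free J q) + total J q = card W"
proof -
  have q: "distinct (q i)" "set (q i) \<subseteq> W" if "i \<in> J" for i
    using assms that by (auto simp: linkage_def linker_def)
  have "card (\<Union>i\<in>J. set (q i)) = (\<Sum>i\<in>J. card (set (q i)))"
    using assms by (intro card_UN_disjoint) (auto simp: linkage_def disjoint_family_on_def)
  also have "\<dots> = total J q"
    using q by (simp add: total_def distinct_card)
  finally have U: "card (\<Union>i\<in>J. set (q i)) = total J q" .
  have "(\<Union>i\<in>J. set (q i)) \<subseteq> W" using q by blast
  then show ?thesis
    using U card_Diff_subset[of "\<Union>i\<in>J. set (q i)" W] card_mono[OF finW, of "\<Union>i\<in>J. set (q i)"] assms(1)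
    by (simp add: free_def)
qed

lemma minimal_length:
  assumes "finite J" "minimal J q" "i \<in> J" "linker i p" "set p \<subseteq> free J q \<union> set (q i)"
  shows "length (q i) \<le> length p"
proof -
  have "linkage J (q(i := p))"
    using linkage_update[of J q i p] assms by (simp add: minimal_def free_remove insert_absorb)
  then have "total J q \<le> total J (q(i := p))" using assms by (simp add: minimal_def)
  then show ?thesis using total_update[OF assms(1,3), of q p] by simp
qed

section \<open>Exchanging a free vertex for an inner vertex\<close>

text \<open>Otherwise the path has two inner vertices and \<open>x\<close> is adjacent to all of it,
  so that \<open>x\<close> alone would link the ends.\<close>

lemma length_le_miss:
  assumes "finite J" "minimal J q" "i \<in> J" "x \<in> free J q"
  shows "length (q i) \<le> card (miss q i x) + 1"
proof (rule ccontr)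
  assume long: "\<not> ?thesis"
  moreover have "length (q i) \<le> 2"
    using linker_if_linkage[OF minimal_imp_linkage] assms by (auto simp: linker_def)
  ultimately have "card (miss q i x) = 0" by simp
  then have "miss q i x = {}" using finite_miss by simp
  then have "linker i [x]"
    using assms(4) by (auto simp: linker_simps miss_def on_path_def free_def adj_commute)
  then show False using minimal_length[OF assms(1-3), of "[x]"] assms(4) long by simp
qed

text \<open>\<open>x\<close> takes the place of an inner vertex \<open>m\<close> adjacent to it. The
  length is kept, so minimality persists, and \<open>m\<close> becomes free.\<close>

lemma swap:
  assumes J: "finite J" "J \<subseteq> K" and q: "minimal J q" and i: "i \<in> J" and x: "x \<in> free J q"
    and few: "card (miss q i x) < length (q i)"
  obtains m q' where "m \<in> set (q i)" "adj x m" "minimal J q'" "free J q' = insert m (free J q - {x})"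
proof -
  have xW: "x \<in> W" "x \<notin> set (q i)" using x i by (auto simp: free_def)
  have "i \<in> K" using i J by auto
  have "\<exists>m p. m \<in> set (q i) \<and> adj x m \<and> linker i p \<and> set p = insert x (set (q i) - {m}) \<and> length p = length (q i)"
    using linker_if_linkage[OF minimal_imp_linkage[OF q] i]
  proof (cases rule: linker_cases)
    case 1
    then show ?thesis using few by simp
  next
    case (2 m)
    then have "miss q i x = {}" using few finite_miss by simp
    then show ?thesis
      using xW 2 by (intro exI[of _ m] exI[of _ "[x]"]) (auto simp: linker_simps miss_def on_path_def adj_commute)
  next
    case (3 m m')
    have link: "m \<in> W" "m' \<in> W" "m \<noteq> m'" "adj (s i) m" "adj m m'" "adj m' (t i)"
      using linker_if_linkage[OF minimal_imp_linkage[OF q] i] 3 by (simp_all add: linker_simps)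
    \<comment> \<open>By minimality \<open>x\<close> does not link the ends on its own, so the one
      path vertex that it misses is an end; \<open>x\<close> then replaces the inner vertex next to
      the other end.\<close>
    have "\<not> linker i [x]" using minimal_length[OF J(1) q i, of "[x]"] x 3 by auto
    then have st: "s i \<in> miss q i x \<or> t i \<in> miss q i x"
      using xW by (auto simp: linker_simps miss_def on_path_def adj_commute)
    have one: "u = v" if "u \<in> miss q i x" "v \<in> miss q i x" for u v
    proof -
      have "card (miss q i x) \<le> Suc 0" using few 3 by simp
      then show ?thesis using that card_le_Suc0_iff_eq[OF finite_miss] by blast
    qed
    show ?thesis
    proof (cases "s i \<in> miss q i x")
      case True
      then have "m \<notin> miss q i x" "m' \<notin> miss q i x" "t i \<notin> miss q i x"
        using one[of "s i"] link(1,2) terminal(3)[OF \<open>i \<in> K\<close>] terminal_neq(1)[OF \<open>i \<in> K\<close> \<open>i \<in> K\<close>] by metis+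
      then show ?thesis
        using xW link 3 by (intro exI[of _ m'] exI[of _ "[m, x]"])
          (auto simp: linker_simps miss_def on_path_def adj_commute)
    next
      case False
      then have "t i \<in> miss q i x" using st by simp
      then have "m \<notin> miss q i x" "m' \<notin> miss q i x"
        using one[of "t i"] link(1,2) terminal(4)[OF \<open>i \<in> K\<close>] by metis+
      then show ?thesis
        using xW link 3 False by (intro exI[of _ m] exI[of _ "[x, m']"])
          (auto simp: linker_simps miss_def on_path_def adj_commute)
    qed
  qed
  then obtain m p where m: "m \<in> set (q i)" "adj x m" and p: "linker i p"
    "set p = insert x (set (q i) - {m})" "length p = length (q i)" by blast
  let ?q = "q(i := p)"
  have "linkage J ?q"
    using linkage_update[of J q i p] q i p x minimal_imp_linkage[OF q] by (auto simp: free_remove insert_absorb)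
  moreover have "total J ?q = total J q" using total_update[OF J(1) i, of q p] p by simp
  ultimately have "minimal J ?q" using q by (simp add: minimal_def)
  moreover have "free J ?q = insert m (free J q - {x})"
  proof -
    have "free J ?q = free (J - {i}) q - set p" using i by (auto simp: free_def split: if_splits)
    also have "\<dots> = (free J q \<union> set (q i)) - set p" using free_remove[OF minimal_imp_linkage[OF q] i] by simp
    also have "\<dots> = insert m (free J q - {x})"
    proof -
      have "free J q \<inter> set (q i) = {}" using i by (auto simp: free_def)
      moreover have "m \<noteq> x" using m(1) xW(2) by auto
      ultimately show ?thesis unfolding p(2) using m(1) xW(2) by auto
    qed
    finally show ?thesis .
  qed
  ultimately show thesis using that[OF m] by simp
qed


lemma on_path_disjoint:
  assumes "J \<subseteq> K" "linkage J q" "i \<in> J" "j \<in> J" "i \<noteq> j"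
  shows "on_path q i \<inter> on_path q j = {}"
proof -
  have "set (q i) \<inter> set (q j) = {}" "set (q i) \<subseteq> W" "set (q j) \<subseteq> W"
    using assms by (simp_all add: linkage_def disjoint_family_on_def linker_def)
  moreover have K: "i \<in> K" "j \<in> K" using assms by auto
  then have "s i \<noteq> s j" "t i \<noteq> t j" "s i \<noteq> t j" "s j \<noteq> t i"
    using terminal_neq assms(5) by simp_all
  moreover have "s i \<notin> set (q j)" "t i \<notin> set (q j)" "s j \<notin> set (q i)" "t j \<notin> set (q i)"
    using calculation(2,3) terminal(3,4)[OF K(1)] terminal(3,4)[OF K(2)] by auto
  ultimately show ?thesis by (simp add: on_path_def)
qed

lemma new_disjoint:
  assumes "J \<subseteq> K" "linkage J q" "i \<in> J" "j \<in> K - J"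
  shows "({s j, t j} \<union> free J q) \<inter> on_path q i = {}"
proof -
  have K: "i \<in> K" "j \<in> K" "i \<noteq> j" and W: "set (q i) \<subseteq> W" using assms by (auto simp: linkage_def linker_def)
  have "s i \<noteq> s j" "t i \<noteq> t j" "s j \<noteq> t i" "s i \<noteq> t j"
    using terminal_neq K by simp_all
  moreover have "s i \<notin> free J q" "t i \<notin> free J q" "s j \<notin> set (q i)" "t j \<notin> set (q i)"
    using W terminal(3,4)[OF K(1)] terminal(3,4)[OF K(2)] by (auto simp: free_def)
  moreover have "free J q \<inter> set (q i) = {}" using assms(3) by (auto simp: free_def)
  ultimately show ?thesis by (auto simp: on_path_def)
qed

lemma on_path_subset: "i \<in> K \<Longrightarrow> linker i (q i) \<Longrightarrow> on_path q i \<subseteq> V"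
  using terminal(1,2)[of i] W(1) by (auto simp: on_path_def linker_def)

text \<open>The vertices missed on different paths and those in \<open>X\<close> form disjoint sets
  of non-neighbours of \<open>v\<close>, and the degree bound applies to their union.\<close>

lemma card_miss_le:
  assumes J: "finite J" "J \<subseteq> K" and q: "linkage J q" and j: "j \<in> K - J"
    and v: "v \<in> {s j, t j} \<union> free J q" and X: "X \<subseteq> {s j, t j} \<union> free J q"
    and nonadj: "\<And>u. u \<in> X \<Longrightarrow> u \<noteq> v \<and> \<not> adj v u"
  shows "card X + (\<Sum>i\<in>J. card (miss q i v)) \<le> \<gamma>"
proof -
  let ?U = "\<Union>i\<in>J. miss q i v"
  have new: "{s j, t j} \<union> free J q \<subseteq> V"
    using terminal[of j] W(1) j by (auto simp: free_def)
  have "card ?U = (\<Sum>i\<in>J. card (miss q i v))"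
  proof (intro card_UN_disjoint ballI impI)
    show "miss q i v \<inter> miss q i' v = {}" if "i \<in> J" "i' \<in> J" "i \<noteq> i'" for i i'
      using on_path_disjoint[OF J(2) q that] by (auto simp: miss_def)
  qed (use J finite_miss in auto)
  moreover have "X \<inter> ?U = {}"
    using new_disjoint[OF J(2) q _ j] X by (fastforce simp: miss_def)
  moreover have "finite X" using X finite_free[of J q] by (meson finite.intros finite_UnI finite_subset)
  ultimately have "card X + (\<Sum>i\<in>J. card (miss q i v)) = card (X \<union> ?U)"
    using J finite_miss by (subst card_Un_disjoint) auto
  also have "\<dots> \<le> card {u \<in> V. u \<noteq> v \<and> \<not> adj v u}"
  proof (rule card_mono)
    have "u \<in> V \<and> u \<noteq> v" if "i \<in> J" "u \<in> miss q i v" for i u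
      using that new_disjoint[OF J(2) q \<open>i \<in> J\<close> j] v J(2) on_path_subset[of i q] linker_if_linkage[OF q \<open>i \<in> J\<close>]
      by (auto simp: miss_def)
    moreover have "X \<subseteq> V" using X new by blast
    ultimately show "X \<union> ?U \<subseteq> {u \<in> V. u \<noteq> v \<and> \<not> adj v u}"
      using nonadj by (auto simp: miss_def)
  qed (use finV in simp)
  also have "\<dots> \<le> \<gamma>" using degree v new by blast
  finally show ?thesis .
qed

section \<open>Missing edges along a minimal linkage\<close>

text \<open>The pairs are the shortcuts that a minimal linkage has to lack, one for each inner
  vertex. A linker has at most two of these, so the tail in the last pattern is empty.\<close>

definition path_matching :: "('i \<Rightarrow> 'v list) \<Rightarrow> 'i \<Rightarrow> 'v set set" where
  "path_matching q i =
     (case q i of [] \<Rightarrow> {} | [x] \<Rightarrow> {{s i, t i}} | x # y # _ \<Rightarrow> {{s i, y}, {x, t i}})"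

text \<open>If one of the pairs were adjacent, \<open>i\<close> would have a shorter linker inside
  its own path.\<close>

lemma path_matching:
  assumes J: "finite J" "J \<subseteq> K" and q: "minimal J q" and i: "i \<in> J"
  shows "nonadj_matching V adj (path_matching q i)" "card (path_matching q i) = length (q i)"
    "\<Union> (path_matching q i) \<subseteq> on_path q i"
proof -
  have link: "linker i (q i)" by (rule linker_if_linkage[OF minimal_imp_linkage[OF q] i])
  have "i \<in> K" using i J by blast
  then have st: "s i \<in> V" "t i \<in> V" "s i \<notin> W" "t i \<notin> W" "s i \<noteq> t i"
    using terminal terminal_neq(1) by auto
  note shorter = minimal_length[OF J(1) q i]
  have "nonadj_matching V adj (path_matching q i) \<and> card (path_matching q i) = length (q i) \<and>
    \<Union> (path_matching q i) \<subseteq> on_path q i"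
    using link
  proof (cases rule: linker_cases)
    case 1
    then show ?thesis by (simp add: path_matching_def nonadj_matching_def)
  next
    case (2 x)
    then have "\<not> adj (s i) (t i)" using shorter[of "[]"] by (auto simp: linker_simps)
    then show ?thesis
      using 2 st by (auto simp: path_matching_def nonadj_matching_def on_path_def)
  next
    case (3 x y)
    then have xy: "x \<in> W" "y \<in> W" "x \<noteq> y" "adj (s i) x" "adj y (t i)" using link by (auto simp: linker_simps)
    have no: "\<not> adj (s i) y" using shorter[of "[y]"] xy 3 by (auto simp: linker_simps)
    have no': "\<not> adj x (t i)" using shorter[of "[x]"] xy 3 by (auto simp: linker_simps)
    have neq: "s i \<noteq> y" "x \<noteq> t i" "s i \<noteq> x" "y \<noteq> t i" using st xy by auto
    then have "disjnt {s i, y} {x, t i}" "disjnt {x, t i} {s i, y}" "{s i, y} \<noteq> {x, t i}"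
      using xy st by (auto simp: disjnt_def doubleton_eq_iff)
    moreover have "x \<in> V" "y \<in> V" using xy W(1) by auto
    moreover have "\<exists>u\<in>V. \<exists>v\<in>V. u \<noteq> v \<and> \<not> adj u v \<and> {s i, y} = {u, v}"
      using no neq st \<open>y \<in> V\<close> by blast
    moreover have "\<exists>u\<in>V. \<exists>v\<in>V. u \<noteq> v \<and> \<not> adj u v \<and> {x, t i} = {u, v}"
      using no' neq st \<open>x \<in> V\<close> by blast
    ultimately show ?thesis
      using 3 by (simp add: path_matching_def nonadj_matching_def on_path_def pairwise_insert)
  qed
  then show "nonadj_matching V adj (path_matching q i)" "card (path_matching q i) = length (q i)"
    "\<Union> (path_matching q i) \<subseteq> on_path q i" by blast+
qed

text \<open>The new pair contributes one more missing edge, disjoint from those on the paths. With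
  the bound on matchings this keeps \<open>total J q\<close> below
  \<open>2 * \<gamma>\<close>.\<close>

lemma total_matching:
  assumes J: "finite J" "J \<subseteq> K" and q: "minimal J q" and j: "j \<in> K - J" and no: "\<not> adj (s j) (t j)"
  obtains M where "nonadj_matching V adj M" "card M = total J q + 1"
proof -
  note link = minimal_imp_linkage[OF q] and pm = path_matching[OF J q]
  let ?U = "\<Union>i\<in>J. path_matching q i"
  have sub: "e \<subseteq> on_path q i \<and> e \<noteq> {}" if "i \<in> J" "e \<in> path_matching q i" for i e
  proof -
    have "\<exists>u v. e = {u, v}"
      using pm(1)[OF that(1)] that(2) unfolding nonadj_matching_def by meson
    then obtain u v where "e = {u, v}" by auto
    then show ?thesis using pm(3)[OF that(1)] that(2) by auto
  qed
  have fin: "finite (path_matching q i)" for i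
    by (auto simp: path_matching_def split: list.split)
  have cross: "disjnt e e'" if "i \<in> J" "i' \<in> J" "i \<noteq> i'" "e \<in> path_matching q i" "e' \<in> path_matching q i'" for i i' e e'
    using sub[OF that(1,4)] sub[OF that(2,5)] on_path_disjoint[OF J(2) link that(1-3)]
    unfolding disjnt_def by blast
  have "card ?U = (\<Sum>i\<in>J. card (path_matching q i))"
  proof (intro card_UN_disjoint ballI impI)
    show "path_matching q i \<inter> path_matching q i' = {}" if "i \<in> J" "i' \<in> J" "i \<noteq> i'" for i i'
    proof (rule ccontr)
      assume "path_matching q i \<inter> path_matching q i' \<noteq> {}"
      then obtain e where "e \<in> path_matching q i" "e \<in> path_matching q i'" by auto
      then show False using cross[OF that, of e e] sub[OF that(1), of e] by (simp add: disjnt_def)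
    qed
  qed (use J fin in auto)
  then have cU: "card ?U = total J q" using pm(2) by (simp add: total_def)
  have st: "s j \<in> V" "t j \<in> V" "s j \<noteq> t j" using terminal terminal_neq(1) j by auto
  have new: "disjnt {s j, t j} e" if "e \<in> ?U" for e
  proof -
    obtain i where "i \<in> J" "e \<in> path_matching q i" using \<open>e \<in> ?U\<close> by auto
    then have "e \<subseteq> on_path q i" "({s j, t j} \<union> free J q) \<inter> on_path q i = {}"
      using sub new_disjoint[OF J(2) link _ j] by auto
    then show ?thesis unfolding disjnt_def by blast
  qed
  have "{s j, t j} \<notin> ?U" using new[of "{s j, t j}"] by (auto simp: disjnt_def)
  then have "card (insert {s j, t j} ?U) = total J q + 1"
    using cU J(1) fin by simp
  moreover have "nonadj_matching V adj (insert {s j, t j} ?U)"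
  proof -
    have "disjnt e e'" if e: "e \<in> ?U" "e' \<in> ?U" "e \<noteq> e'" for e e'
    proof -
      obtain i i' where "i \<in> J" "e \<in> path_matching q i" "i' \<in> J" "e' \<in> path_matching q i'"
        using e(1,2) by auto
      then show ?thesis
        using cross[of i i' e e'] pm(1)[of i] e(3)
        by (cases "i = i'") (simp_all add: nonadj_matching_def pairwise_def)
    qed
    then have "pairwise disjnt ?U" by (simp only: pairwise_def) blast
    then have "pairwise disjnt (insert {s j, t j} ?U)"
      using new disjnt_sym unfolding pairwise_insert by blast
    moreover have "\<exists>u\<in>V. \<exists>v\<in>V. u \<noteq> v \<and> \<not> adj u v \<and> e = {u, v}" if "e \<in> ?U" for e
    proof -
      obtain i where "i \<in> J" "e \<in> path_matching q i" using \<open>e \<in> ?U\<close> by auto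
      then show ?thesis using pm(1)[of i] unfolding nonadj_matching_def by simp
    qed
    ultimately show ?thesis
      using st no unfolding nonadj_matching_def by (metis insert_iff)
  qed
  ultimately show thesis using that by blast
qed

section \<open>Adding one pair\<close>

text \<open>The assumption to be refuted concerns every linkage of \<open>J\<close>, so its
  consequences \<open>c1\<close> and \<open>c2\<close> remain available after each exchange.\<close>

lemma extend_linkage:
  assumes J: "finite J" "J \<subseteq> K" and j: "j \<in> K - J" and q0: "linkage J q0"
  shows "\<exists>q. linkage (insert j J) q"
proof (rule ccontr)
  assume contra: "\<not> ?thesis"
  let ?S = "s j" and ?T = "t j"
  have no: False if "linkage J q" "linker j p" "set p \<subseteq> free J q" for q p
    using linkage_update[of J q j p] that j contra by auto
  have ST: "\<not> adj ?S ?T" using no[OF q0, of "[]"] by (auto simp: linker_simps)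
  have st: "?S \<in> V" "?T \<in> V" "?S \<notin> W" "?T \<notin> W" "?S \<noteq> ?T" using terminal[of j] terminal_neq(1)[of j j] j by auto
  have freeW: "free J q \<subseteq> W" for q by (auto simp: free_def)
  have c1: "\<not> (adj ?S x \<and> adj ?T x)" if "linkage J q" "x \<in> free J q" for q x
    using no[of q "[x]"] that freeW[of q] by (auto simp: linker_simps adj_commute)
  have c2: "\<not> (adj ?S x \<and> adj x y \<and> adj ?T y)"
    if "linkage J q" "x \<in> free J q" "y \<in> free J q" for q x y
    using no[of q "[x, y]"] c1[of q x] that freeW[of q] by (auto simp: linker_simps adj_commute)
  \<comment> \<open>The bound on matchings yields one free vertex \<open>x\<close>. If it were
    tight, every vertex would have at most one non-neighbour; \<open>?S\<close> and
    \<open>?T\<close> miss each other, so both would be adjacent to \<open>x\<close>, against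
    \<open>c1\<close>.\<close>
  have two: "2 \<le> card (free J q)" if q: "minimal J q" for q
  proof -
    obtain M where M: "nonadj_matching V adj M" "card M = total J q + 1"
      using total_matching[OF J q j ST] by blast
    then have le: "total J q + 1 \<le> 2 * \<gamma>" using matching by fastforce
    have free: "card (free J q) + total J q = card W" by (rule card_free[OF J(1) minimal_imp_linkage[OF q]])
    have "total J q + 1 \<noteq> 2 * \<gamma>"
    proof
      assume "total J q + 1 = 2 * \<gamma>"
      then have one: "card {u \<in> V. u \<noteq> v \<and> \<not> adj v u} \<le> 1" if "v \<in> V" for v
        using large_matching[OF M(1)] M(2) that by simp
      have "free J q \<noteq> {}" using free le W(2) by auto
      then obtain x where x: "x \<in> free J q" by blast
      then have xV: "x \<in> V" "x \<noteq> ?S" "x \<noteq> ?T" using freeW W(1) st by auto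
      have adj: "adj v x" if "v \<in> V" "v' \<in> V" "v \<noteq> v'" "\<not> adj v v'" "x \<noteq> v" "x \<noteq> v'" for v v'
      proof (rule ccontr)
        assume "\<not> adj v x"
        then have "{v', x} \<subseteq> {u \<in> V. u \<noteq> v \<and> \<not> adj v u}" using that xV by auto
        then have "card {v', x} \<le> 1"
          using card_mono[of "{u \<in> V. u \<noteq> v \<and> \<not> adj v u}" "{v', x}"] one[OF that(1)] finV by simp
        then show False using that by simp
      qed
      have "adj ?S x" "adj ?T x"
        using adj[of ?S ?T] adj[of ?T ?S] st xV ST adj_commute by auto
      then show False using c1[OF minimal_imp_linkage[OF q] x] by blast
    qed
    then show ?thesis using free le W(2) by simp
  qed
  have reach: "\<exists>q'. minimal J q' \<and> y \<in> free J q' \<and> (\<exists>m\<in>free J q'. adj Z m)"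
    if Z: "Z = ?S \<and> Z' = ?T \<or> Z = ?T \<and> Z' = ?S" and q: "minimal J q" and y: "y \<in> free J q" for Z Z' q y
  proof (cases "\<exists>m\<in>free J q. adj Z m")
    case True
    then show ?thesis using q y by blast
  next
    case False
    note link = minimal_imp_linkage[OF q]
    have ZZ: "Z \<noteq> Z'" "\<not> adj Z Z'" "Z \<notin> W" "Z' \<notin> W" using Z st ST adj_commute by auto
    obtain z where z: "z \<in> free J q" "z \<noteq> y"
    proof -
      have "\<not> free J q \<subseteq> {y}" using two[OF q] card_mono[of "{y}" "free J q"] by auto
      then show thesis using that by blast
    qed
    \<comment> \<open>\<open>Z\<close> misses \<open>Z'\<close> and all free vertices, and
      \<open>z\<close> misses \<open>Z\<close>. The two degree bounds leave these vertices fewer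
      than \<open>total J q\<close> misses on the paths, so on some path \<open>Z\<close> misses
      nothing and \<open>z\<close> can be exchanged for an inner vertex, a neighbour of
      \<open>Z\<close>. As \<open>z\<close> differs from \<open>y\<close>, the latter stays
      free.\<close>
    have "card (insert Z' (free J q)) + (\<Sum>i\<in>J. card (miss q i Z)) \<le> \<gamma>"
      using False ZZ Z freeW by (intro card_miss_le[OF J link j]) auto
    moreover have "card {Z} + (\<Sum>i\<in>J. card (miss q i z)) \<le> \<gamma>"
      using False ZZ Z z freeW adj_commute by (intro card_miss_le[OF J link j]) auto
    moreover have "card (insert Z' (free J q)) = card (free J q) + 1"
      using finite_free ZZ freeW[of q] by (subst card_insert_disjoint) auto
    ultimately have "(\<Sum>i\<in>J. card (miss q i Z) + card (miss q i z)) < total J q"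
      using card_free[OF J(1) link] W(2) by (simp add: sum.distrib)
    then obtain i where i: "i \<in> J" "card (miss q i Z) + card (miss q i z) < length (q i)"
      unfolding total_def by (meson not_less sum_mono)
    then have "card (miss q i Z) = 0" using length_le_miss[OF J(1) q i(1) z(1)] by simp
    then have Zi: "miss q i Z = {}" using finite_miss by simp
    obtain m q' where m: "m \<in> set (q i)" "minimal J q'" "free J q' = insert m (free J q - {z})"
    proof -
      have "card (miss q i z) < length (q i)" using i(2) by simp
      from swap[OF J q i(1) z(1) this] show thesis using that by metis
    qed
    then have "adj Z m" using Zi by (auto simp: miss_def on_path_def)
    then show ?thesis using m y z by (intro exI[of _ q']) auto
  qed
  obtain q1 where q1: "minimal J q1"
    using ex_has_least_nat[of "linkage J" q0 "total J"] q0 unfolding minimal_def by blast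
  \<comment> \<open>\<open>?T\<close> is served first; the exchange for \<open>?S\<close> then keeps
    the free neighbour \<open>y\<close> of \<open>?T\<close>.\<close>
  obtain y1 where "y1 \<in> free J q1" using two[OF q1] by fastforce
  then obtain q2 y where "minimal J q2" "y \<in> free J q2" "adj ?T y"
    using reach[of ?T ?S q1 y1] q1 by blast
  then obtain q x where q: "minimal J q" and xy: "x \<in> free J q" "y \<in> free J q" "adj ?S x" "adj ?T y"
    using reach[of ?S ?T q2 y] by blast
  note link = minimal_imp_linkage[OF q]
  have neq: "x \<noteq> y" "x \<noteq> ?S" "x \<noteq> ?T" "y \<noteq> ?S" "y \<noteq> ?T"
    using xy c1[OF link] freeW[of q] st by auto
  have nonadj: "\<not> adj ?T x" "\<not> adj ?S y" using xy c1[OF link] by auto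
  let ?F = "free J q" and ?c = "\<lambda>v i. card (miss q i v)"
  \<comment> \<open>By \<open>c1\<close> and \<open>c2\<close>, \<open>x\<close> misses
    \<open>?T\<close> and all free neighbours of \<open>?T\<close>, and \<open>y\<close> misses
    \<open>?S\<close> and all free neighbours of \<open>?S\<close>. In the sum of the four bounds
    every free vertex is thus counted twice, which leaves fewer than \<open>2 * total J q\<close>
    misses on the paths.\<close>
  have S: "card (insert ?T {u \<in> ?F. \<not> adj ?S u}) + (\<Sum>i\<in>J. ?c ?S i) \<le> \<gamma>"
    using st ST freeW[of q] by (intro card_miss_le[OF J link j]) auto
  have T: "card (insert ?S {u \<in> ?F. \<not> adj ?T u}) + (\<Sum>i\<in>J. ?c ?T i) \<le> \<gamma>"
    using st ST freeW[of q] adj_commute by (intro card_miss_le[OF J link j]) auto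
  have X: "card (insert ?T {u \<in> ?F. adj ?T u}) + (\<Sum>i\<in>J. ?c x i) \<le> \<gamma>"
    using xy neq nonadj c2[OF link xy(1)] by (intro card_miss_le[OF J link j]) (auto simp: adj_commute)
  have Y: "card (insert ?S {u \<in> ?F. adj ?S u}) + (\<Sum>i\<in>J. ?c y i) \<le> \<gamma>"
    using xy neq nonadj c2[OF link _ xy(2)] by (intro card_miss_le[OF J link j]) (auto simp: adj_commute)
  have split: "card {u \<in> ?F. \<not> adj v u} + card {u \<in> ?F. adj v u} = card ?F" for v
    using finite_free[of J q] by (subst card_Un_disjoint[symmetric]) (auto intro!: arg_cong[of _ _ card])
  have ins: "card (insert v {u \<in> ?F. P u}) = card {u \<in> ?F. P u} + 1" if "v \<notin> W" for v P
    using finite_free[of J q] freeW[of q] that by (subst card_insert_disjoint) auto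
  have "(\<Sum>i\<in>J. ?c ?S i + ?c ?T i + ?c x i + ?c y i) < 2 * total J q"
    using S T X Y split[of ?S] split[of ?T] card_free[OF J(1) link] W(2) st(3,4)
    by (simp add: sum.distrib ins)
  also have "\<dots> = (\<Sum>i\<in>J. 2 * length (q i))" by (simp add: total_def sum_distrib_left)
  finally obtain i where i: "i \<in> J" and lt: "?c ?S i + ?c ?T i + ?c x i + ?c y i < 2 * length (q i)"
    by (meson not_less sum_mono)
  have ge: "length (q i) \<le> ?c x i + 1" "length (q i) \<le> ?c y i + 1"
    using length_le_miss[OF J(1) q i] xy by auto
  let ?B = "miss q i ?S \<union> miss q i ?T"
  have exch: "\<exists>m q'. m \<in> ?B \<and> m \<in> set (q i) \<and> adj z m \<and> minimal J q' \<and> free J q' = insert m (?F - {z})"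
    if z: "z \<in> ?F" "?c z i < length (q i)" for z
  proof -
    obtain m q' where m: "m \<in> set (q i)" "adj z m" "minimal J q'" "free J q' = insert m (?F - {z})"
      using swap[OF J q i z] by metis
    \<comment> \<open>\<open>m\<close> is free after the exchange, so \<open>c1\<close> applies to
      it in the new linkage.\<close>
    moreover have "\<not> (adj ?S m \<and> adj ?T m)" using c1[OF minimal_imp_linkage[OF m(3)]] m(4) by blast
    ultimately show ?thesis by (intro exI[of _ m] exI[of _ q']) (auto simp: miss_def on_path_def)
  qed
  have B: "0 < card ?B" if "z \<in> ?F" "?c z i < length (q i)" for z
    using exch[OF that] finite_miss by (auto simp: card_gt_0_iff)
  \<comment> \<open>By \<open>lt\<close>, \<open>x\<close> or \<open>y\<close> misses fewer than
    \<open>length (q i)\<close> vertices and can be exchanged, so \<open>?B\<close> is non-empty.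
    Together with \<open>ge\<close>, \<open>lt\<close> then leaves no slack: both can be exchanged,
    and \<open>?S\<close> and \<open>?T\<close> have just one miss between them.\<close>
  have "0 < card ?B"
  proof (cases "?c x i < length (q i)")
    case True
    then show ?thesis by (rule B[OF xy(1)])
  next
    case False
    then show ?thesis using lt by (intro B[OF xy(2)]) linarith
  qed
  then have pos: "0 < ?c ?S i + ?c ?T i"
    using card_Un_le[of "miss q i ?S" "miss q i ?T"] by linarith
  then have few: "?c x i < length (q i)" "?c y i < length (q i)" "?c ?S i + ?c ?T i \<le> 1"
    using lt ge by linarith+
  obtain m q' where m: "m \<in> ?B" "m \<in> set (q i)" "adj x m" "minimal J q'" "free J q' = insert m (?F - {x})"
    using exch[OF xy(1) few(1)] by metis
  obtain m' q'' where m': "m' \<in> ?B" "m' \<in> set (q i)" "adj y m'" "minimal J q''" "free J q'' = insert m' (?F - {y})"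
    using exch[OF xy(2) few(2)] by metis
  have "card ?B \<le> Suc 0" using few(3) card_Un_le[of "miss q i ?S" "miss q i ?T"] by simp
  \<comment> \<open>Both exchanges free the only vertex of \<open>?B\<close>. If \<open>?S\<close>
    is adjacent to it, putting \<open>x\<close> on the path opens the route through \<open>m\<close>
    and \<open>y\<close>; otherwise putting \<open>y\<close> there opens the route through
    \<open>x\<close> and \<open>m\<close>.\<close>
  then have "m = m'" using m(1) m'(1) finite_miss by (auto simp: card_le_Suc0_iff_eq)
  have "miss q i ?S = {} \<or> miss q i ?T = {}"
    using few(3) finite_miss card_0_eq by (metis One_nat_def add_is_1 le_Suc_eq le_zero_eq add_is_0)
  then have "adj ?S m \<or> adj ?T m" using m(2) by (auto simp: miss_def on_path_def)
  then show False
  proof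
    assume "adj ?S m"
    then show False
      using c2[OF minimal_imp_linkage[OF m(4)], of m y] m m' xy neq \<open>m = m'\<close> by (auto simp: adj_commute)
  next
    assume "adj ?T m"
    then show False
      using c2[OF minimal_imp_linkage[OF m'(4)], of x m] m m' xy neq \<open>m = m'\<close> by auto
  qed
qed

lemma ex_linkage: "\<exists>q. linkage K q"
proof -
  have "\<exists>q. linkage J q" if "finite J" "J \<subseteq> K" for J
    using that
  proof (induction J rule: finite_induct)
    case empty
    then show ?case by (simp add: linkage_def disjoint_family_on_def)
  next
    case (insert j J)
    then show ?case using extend_linkage[of J j] by auto
  qed
  then show ?thesis using finK by blast
qed

end

subsection \<open>The linkedness of polytopes with few vertices\<close>

lemma polytope_vertices_props:
  fixes P :: "'a::euclidean_space set"
  assumes "polytope P"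
  shows "finite (polytope_vertices P)" "convex hull (polytope_vertices P) = P"
    "v \<in> polytope_vertices P \<Longrightarrow> v \<notin> convex hull (polytope_vertices P - {v})"
proof -
  obtain S where S: "finite S" "P = convex hull S" using assms by (auto simp: polytope_def)
  have "polytope_vertices P \<subseteq> S"
    using extreme_point_of_convex_hull by (auto simp: polytope_vertices_def S(2))
  then show "finite (polytope_vertices P)" using S(1) finite_subset by blast
  show hull: "convex hull (polytope_vertices P) = P"
    using Krein_Milman_Minkowski[of P] assms
    by (simp add: polytope_vertices_def polytope_imp_compact polytope_imp_convex)
  show "v \<notin> convex hull (polytope_vertices P - {v})" if "v \<in> polytope_vertices P"
  proof -
    have "convex (P - {v})" "polytope_vertices P \<subseteq> P"
      using that hull hull_subset[of "polytope_vertices P" convex]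
      by (auto simp: polytope_vertices_def extreme_point_of_stillconvex polytope_imp_convex[OF assms])
    then have "convex hull (polytope_vertices P - {v}) \<subseteq> P - {v}"
      by (intro hull_minimal) auto
    then show ?thesis by blast
  qed
qed

text \<open>The terminals leave \<open>d + \<gamma> + 1 - 2 * k\<close> vertices, and the bound on
  \<open>k\<close> says that these are at least \<open>2 * \<gamma>\<close>. The other assumptions
  of \<open>linking\<close> come from the relations of missing edges.\<close>

lemma polytope_linked_lower_bound:
  fixes P :: "'a::euclidean_space set"
  assumes P: "P \<in> polytope_class d \<gamma>" and k: "2 * k + \<gamma> \<le> d + 1"
  shows "polytope_linked P k"
proof -
  define V where "V = polytope_vertices P"
  define adj where "adj u v \<longleftrightarrow> {u, v} \<in> polytope_edges P" for u v
  have poly: "polytope P" and card: "card V = d + \<gamma> + 1" and dim: "aff_dim P = int d"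
    using P by (auto simp: polytope_class_def V_def)
  note props = polytope_vertices_props[OF poly, folded V_def]
  have Vdim: "aff_dim V = int d" using dim props(2) aff_dim_convex_hull by metis
  note V = props(1) Vdim card
  have ex: "\<exists>f. affine_relation V f \<and> (\<forall>w\<in>V. 0 < f w \<longleftrightarrow> w = u \<or> w = v)"
    if "u \<in> V" "v \<in> V" "u \<noteq> v" "\<not> adj u v" for u v
  proof -
    have "\<not> closed_segment u v edge_of (convex hull V)"
    proof -
      have "{u, v} \<in> polytope_edges P" if "closed_segment u v edge_of P"
        using that \<open>u \<in> V\<close> \<open>v \<in> V\<close> unfolding polytope_edges_def V_def by blast
      then show ?thesis using that(4) unfolding adj_def props(2) by blast
    qed
    from non_edge_relation[OF props(1,3) that(1-3) this] show ?thesis by metis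
  qed
  have degree: "card {u \<in> V. u \<noteq> v \<and> \<not> adj v u} \<le> \<gamma>" if v: "v \<in> V" for v
  proof -
    let ?B = "{u \<in> V. u \<noteq> v \<and> \<not> adj v u}"
    have "\<forall>b\<in>?B. \<exists>f. affine_relation V f \<and> (\<forall>w\<in>V. 0 < f w \<longleftrightarrow> w = v \<or> w = b)"
    proof
      fix b assume "b \<in> ?B"
      then show "\<exists>f. affine_relation V f \<and> (\<forall>w\<in>V. 0 < f w \<longleftrightarrow> w = v \<or> w = b)"
        using ex[OF v, of b] by auto
    qed
    from bchoice[OF this]
    obtain f where f: "\<forall>b\<in>?B. affine_relation V (f b) \<and> (\<forall>w\<in>V. 0 < f b w \<longleftrightarrow> w = v \<or> w = b)" ..
    show ?thesis
      by (rule card_star_le[OF V v props(3)[OF v], where f = f]) (use f in auto)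
  qed
  have pairs: "card M \<le> 2 * \<gamma>"
    "\<lbrakk>card M = 2 * \<gamma>; u \<in> V; v \<in> V; u \<noteq> v; \<not> adj u v\<rbrakk> \<Longrightarrow> {u, v} \<in> M"
    if M: "nonadj_matching V adj M" for M u v
  proof -
    have "\<exists>f. affine_relation V f \<and> (\<forall>w\<in>V. 0 < f w \<longleftrightarrow> w \<in> e)" and e: "e \<subseteq> V \<and> card e = 2" if "e \<in> M" for e
    proof -
      have "\<exists>u\<in>V. \<exists>v\<in>V. u \<noteq> v \<and> \<not> adj u v \<and> e = {u, v}"
        using M that unfolding nonadj_matching_def by simp
      then obtain u v where uv: "u \<in> V" "v \<in> V" "u \<noteq> v" "\<not> adj u v" "e = {u, v}"
        by (elim bexE conjE)
      then show "\<exists>f. affine_relation V f \<and> (\<forall>w\<in>V. 0 < f w \<longleftrightarrow> w \<in> e)" "e \<subseteq> V \<and> card e = 2"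
        using ex[OF uv(1-4)] by auto
    qed
    then have "\<forall>e\<in>M. \<exists>f. affine_relation V f \<and> (\<forall>w\<in>V. 0 < f w \<longleftrightarrow> w \<in> e)" by simp
    from bchoice[OF this]
    obtain f where f: "\<forall>e\<in>M. affine_relation V (f e) \<and> (\<forall>w\<in>V. 0 < f e w \<longleftrightarrow> w \<in> e)" ..
    have disj: "pairwise disjnt M" using M by (simp add: nonadj_matching_def)
    have rel: "affine_relation V (f e)" if "e \<in> M" for e using f that by blast
    have pos: "0 < f e w \<longleftrightarrow> w \<in> e" if "e \<in> M" "w \<in> V" for e w using f that by blast
    note main = matching_of_positive_pairs[OF V props(3) disj e rel pos]
    show "card M \<le> 2 * \<gamma>" by (rule main(1))
    show "{u, v} \<in> M" if asm: "card M = 2 * \<gamma>" "u \<in> V" "v \<in> V" "u \<noteq> v" "\<not> adj u v"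
    proof -
      from ex[OF asm(2-5)]
      obtain g where g: "affine_relation V g \<and> (\<forall>w\<in>V. 0 < g w \<longleftrightarrow> w = u \<or> w = v)" ..
      show ?thesis using g asm by (intro main(2)[of g u v]) simp_all
    qed
  qed
  have large: "card {u \<in> V. u \<noteq> v \<and> \<not> adj v u} \<le> 1"
    if M: "nonadj_matching V adj M" "card M = 2 * \<gamma>" and v: "v \<in> V" for M v
  proof -
    \<comment> \<open>In the equality case two non-neighbours of \<open>v\<close> would give two
      pairs of \<open>M\<close> that meet in \<open>v\<close>.\<close>
    have "u = u'" if "u \<in> V" "u \<noteq> v" "\<not> adj v u" "u' \<in> V" "u' \<noteq> v" "\<not> adj v u'" for u u'
    proof -
      have "{v, u} \<in> M" "{v, u'} \<in> M" using pairs(2)[OF M] v that by auto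
      moreover have "\<not> disjnt {v, u} {v, u'}" by (simp add: disjnt_def)
      ultimately have "{v, u} = {v, u'}" using M(1) unfolding nonadj_matching_def pairwise_def by metis
      then show ?thesis using that by (auto simp: doubleton_eq_iff)
    qed
    then have "card {u \<in> V. u \<noteq> v \<and> \<not> adj v u} \<le> Suc 0"
      using props(1) by (subst card_le_Suc0_iff_eq) auto
    then show ?thesis by simp
  qed
  have "\<exists>L. (\<forall>i<k. graph_path V (polytope_edges P) (L i) \<and> hd (L i) = s i \<and> last (L i) = t i) \<and>
             (\<forall>i<k. \<forall>j<k. i \<noteq> j \<longrightarrow> set (L i) \<inter> set (L j) = {})"
    if st: "s ` {..<k} \<subseteq> V" "t ` {..<k} \<subseteq> V" "inj_on s {..<k}" "inj_on t {..<k}"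
      "s ` {..<k} \<inter> t ` {..<k} = {}" for s t :: "nat \<Rightarrow> 'a"
  proof -
    define W where "W = V - (s ` {..<k} \<union> t ` {..<k})"
    have "card (s ` {..<k} \<union> t ` {..<k}) = 2 * k"
      using st by (simp add: card_Un_disjoint card_image)
    then have "card W = card V - 2 * k"
      using st by (simp add: W_def card_Diff_subset)
    then have W: "2 * \<gamma> \<le> card W" using card k by simp
    interpret linking V adj \<gamma> "{..<k}" s t W
    proof
      show "adj u v \<Longrightarrow> adj v u" for u v by (simp add: adj_def insert_commute)
      show "card M \<le> 2 * \<gamma>" if "nonadj_matching V adj M" for M using pairs(1)[OF that] .
      show "s ` {..<k} \<subseteq> V - W" "t ` {..<k} \<subseteq> V - W" using st by (auto simp: W_def)
      show "W \<subseteq> V" by (auto simp: W_def)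
      show "card {u \<in> V. u \<noteq> v \<and> \<not> adj v u} \<le> 1"
        if "nonadj_matching V adj M" "card M = 2 * \<gamma>" "v \<in> V" for M v by (rule large[OF that])
    qed (simp_all add: props(1) degree W st)
    obtain q where q: "linkage {..<k} q" using ex_linkage by blast
    define L where "L i = s i # q i @ [t i]" for i
    have set: "set (L i) = on_path q i" for i by (auto simp: L_def on_path_def)
    have "graph_path V (polytope_edges P) (L i) \<and> hd (L i) = s i \<and> last (L i) = t i" if "i < k" for i
    proof -
      have i: "i \<in> {..<k}" using that by simp
      have link: "linker i (q i)" by (rule linker_if_linkage[OF q i])
      have "successively adj (L i)" using link by (simp add: linker_def L_def)
      moreover have "adj = (\<lambda>u v. {u, v} \<in> polytope_edges P)" by (intro ext) (simp add: adj_def)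
      ultimately have "successively (\<lambda>u v. {u, v} \<in> polytope_edges P) (L i)" by (rule subst[rotated])
      moreover have "distinct (L i)"
        using link terminal[OF i] terminal_neq(1)[OF i i] by (auto simp: linker_def L_def)
      moreover have "set (L i) \<subseteq> V" unfolding set using on_path_subset[of i q] i link by simp
      ultimately show ?thesis by (simp add: graph_path_def L_def)
    qed
    moreover have "set (L i) \<inter> set (L j) = {}" if "i < k" "j < k" "i \<noteq> j" for i j
      unfolding set using that by (intro on_path_disjoint[OF subset_refl q]) auto
    ultimately show ?thesis by blast
  qed
  then show ?thesis
    unfolding polytope_linked_def k_linked_def V_def[symmetric]
    using props(1) card k by auto
qed

section \<open>A counting obstruction to linkedness\<close>

text \<open>Used as terminals, the \<open>m\<close> non-adjacent pairs need three vertices each and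
  the other \<open>k - m\<close> pairs two, which makes \<open>2 * k + m\<close> in all.\<close>

lemma not_k_linked:
  fixes p p' :: "nat \<Rightarrow> 'v"
  assumes V: "p ` {..<m} \<subseteq> V" "p' ` {..<m} \<subseteq> V"
    and inj: "inj_on p {..<m}" "inj_on p' {..<m}" "p ` {..<m} \<inter> p' ` {..<m} = {}"
    and non_edge: "\<And>i. i < m \<Longrightarrow> {p i, p' i} \<notin> E"
    and m: "m \<le> k" and card: "card V < 2 * k + m"
  shows "\<not> k_linked V E k"
proof
  assume linked: "k_linked V E k"
  then have fin: "finite V" and le: "2 * k \<le> card V" by (auto simp: k_linked_def)
  define U where "U = V - (p ` {..<m} \<union> p' ` {..<m})"
  have "card (p ` {..<m} \<union> p' ` {..<m}) = 2 * m"
    using inj by (simp add: card_Un_disjoint card_image)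
  then have "card U = card V - 2 * m"
    using V by (simp add: U_def card_Diff_subset)
  then have cU: "2 * (k - m) \<le> card U" using le by simp
  have "finite U" using fin by (simp add: U_def)
  then obtain h where h: "bij_betw h {0..<card U} U" using ex_bij_betw_nat_finite by blast
  \<comment> \<open>The other pairs are arbitrary: an even position of an enumeration of
    \<open>U\<close> and the odd position after it.\<close>
  define h0 where "h0 i = h (2 * (i - m))" for i
  define h1 where "h1 i = h (2 * (i - m) + 1)" for i
  have idx: "2 * (i - m) < card U" "2 * (i - m) + 1 < card U" if "i < k" "\<not> i < m" for i
    using that cU by auto
  have hU: "h0 i \<in> U" "h1 i \<in> U" if "i < k" "\<not> i < m" for i
    using bij_betwE[OF h] idx[OF that] unfolding h0_def h1_def by auto
  have inj_h: "h n = h n' \<longleftrightarrow> n = n'" if "n < card U" "n' < card U" for n n'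
    using bij_betw_imp_inj_on[OF h] that by (simp add: inj_on_eq_iff)
  have h_eq: "h0 i = h0 j \<longleftrightarrow> i = j" "h1 i = h1 j \<longleftrightarrow> i = j" "h0 i \<noteq> h1 j"
    if "i < k" "\<not> i < m" "j < k" "\<not> j < m" for i j
  proof -
    have "2 * (i - m) \<noteq> 2 * (j - m) + 1" by presburger
    then show "h0 i \<noteq> h1 j" unfolding h0_def h1_def using inj_h idx that by simp
    have "i - m = j - m \<longleftrightarrow> i = j" using that by auto
    then show "h0 i = h0 j \<longleftrightarrow> i = j" "h1 i = h1 j \<longleftrightarrow> i = j"
      unfolding h0_def h1_def using inj_h idx that by simp_all
  qed
  define s where "s i = (if i < m then p i else h0 i)" for i
  define t where "t i = (if i < m then p' i else h1 i)" for i
  have pV: "p i \<in> V" "p' i \<in> V" "p i \<notin> U" "p' i \<notin> U" if "i < m" for i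
    using that V by (auto simp: U_def)
  have UV: "u \<in> V" if "u \<in> U" for u using that by (simp add: U_def)
  have s: "s i \<in> V" "t i \<in> V" if "i < k" for i
    using that pV hU UV by (simp_all add: s_def t_def)
  have ne: "h0 i \<noteq> p j" "p j \<noteq> h0 i" "h1 i \<noteq> p' j" "p' j \<noteq> h1 i" "h0 i \<noteq> p' j" "p j \<noteq> h1 i"
    if "i < k" "\<not> i < m" "j < m" for i j
    using hU[OF that(1,2)] pV(3,4)[OF that(3)] by metis+
  have p_eq: "p i = p j \<longleftrightarrow> i = j" "p' i = p' j \<longleftrightarrow> i = j" "p i \<noteq> p' j" if "i < m" "j < m" for i j
  proof -
    show "p i = p j \<longleftrightarrow> i = j" "p' i = p' j \<longleftrightarrow> i = j" using inj(1,2) that by (simp_all add: inj_on_eq_iff)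
    show "p i \<noteq> p' j" using inj(3) that by (metis disjoint_iff imageI lessThan_iff)
  qed
  have s_eq: "s i = s j \<longleftrightarrow> i = j" "t i = t j \<longleftrightarrow> i = j" and st: "s i \<noteq> t j" if "i < k" "j < k" for i j
    using that by (cases "i < m"; cases "j < m"; auto simp: s_def t_def h_eq ne p_eq)+
  have inj_s: "inj_on s {..<k}" and inj_t: "inj_on t {..<k}"
    using s_eq by (auto intro!: inj_onI)
  have terminals: "s ` {..<k} \<subseteq> V \<and> t ` {..<k} \<subseteq> V \<and>
      inj_on s {..<k} \<and> inj_on t {..<k} \<and> s ` {..<k} \<inter> t ` {..<k} = {}"
    using s inj_s inj_t st by auto
  note all = linked[unfolded k_linked_def, THEN conjunct2, THEN conjunct2]
  from mp[OF spec[OF spec[OF all, of s], of t] terminals]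
  obtain L where "(\<forall>i<k. graph_path V E (L i) \<and> hd (L i) = s i \<and> last (L i) = t i) \<and>
      (\<forall>i<k. \<forall>j<k. i \<noteq> j \<longrightarrow> set (L i) \<inter> set (L j) = {})" ..
  then have L: "\<And>i. i < k \<Longrightarrow> graph_path V E (L i) \<and> hd (L i) = s i \<and> last (L i) = t i"
    and disj: "\<And>i j. i < k \<Longrightarrow> j < k \<Longrightarrow> i \<noteq> j \<Longrightarrow> set (L i) \<inter> set (L j) = {}" by simp_all
  have size: "(if i < m then 3 else 2) \<le> card (set (L i))" if i: "i < k" for i
  proof -
    have path: "graph_path V E (L i)" "hd (L i) = s i" "last (L i) = t i" using L[OF i] by auto
    have "s i \<noteq> t i" using st i by blast
    have "card (set (L i)) = length (L i)" using path(1) by (simp add: graph_path_def distinct_card)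
    moreover have "length (L i) \<noteq> 1" using path(2,3) \<open>s i \<noteq> t i\<close> by (auto simp: length_Suc_conv)
    moreover have "length (L i) \<noteq> 2" if "i < m"
    proof
      assume "length (L i) = 2"
      then obtain x y where "L i = [x, y]" by (auto simp: numeral_2_eq_2 length_Suc_conv)
      then have "{s i, t i} \<in> E" using path by (auto simp: graph_path_def)
      then show False using non_edge[OF that] that by (simp add: s_def t_def)
    qed
    moreover have "length (L i) \<noteq> 0" using path(1) by (simp add: graph_path_def)
    ultimately show ?thesis by (cases "i < m"; simp; arith)
  qed
  have "2 * k + m = (\<Sum>i<k. if i < m then 3 else 2)"
  proof -
    have "(\<Sum>i<k. if i < m then 3 else 2) = (\<Sum>i<k. 2 + (if i < m then 1 else 0 :: nat))"
      by (intro sum.cong) auto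
    also have "\<dots> = 2 * k + card {i \<in> {..<k}. i < m}"
      by (simp only: sum.distrib sum.inter_filter[symmetric] finite_lessThan) simp
    also have "{i \<in> {..<k}. i < m} = {..<m}" using m by auto
    finally show ?thesis by simp
  qed
  also have "\<dots> \<le> (\<Sum>i<k. card (set (L i)))" using size by (intro sum_mono) auto
  also have "\<dots> = card (\<Union>i<k. set (L i))"
    using disj by (intro card_UN_disjoint[symmetric]) auto
  also have "\<dots> \<le> card V"
    using L fin by (intro card_mono) (auto simp: graph_path_def)
  finally show False using card by simp
qed

section \<open>The extremal polytope\<close>

lemma not_in_convex_hull_if_separated:
  fixes v a :: "'a::euclidean_space"
  assumes "\<And>w. w \<in> S \<Longrightarrow> a \<bullet> w < a \<bullet> v"
  shows "v \<notin> convex hull S"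
proof -
  have "convex hull S \<subseteq> {w. a \<bullet> w < a \<bullet> v}"
    using assms by (intro hull_minimal convex_halfspace_lt) auto
  then show ?thesis by auto
qed

text \<open>The two segments share their midpoint, so if the first were a face it would contain
  \<open>w\<close>; then \<open>w\<close> would lie strictly between \<open>u\<close> and
  \<open>v\<close> and be no vertex.\<close>

lemma diagonal_not_edge:
  fixes P :: "'a::euclidean_space set"
  assumes vert: "u \<in> polytope_vertices P" "v \<in> polytope_vertices P" "w \<in> polytope_vertices P" "w' \<in> polytope_vertices P"
    and distinct: "w \<noteq> w'" "w \<noteq> u" "w \<noteq> v" and sum: "u + v = w + w'"
  shows "{u, v} \<notin> polytope_edges P"
proof
  assume "{u, v} \<in> polytope_edges P"
  then obtain x y where xy: "{u, v} = {x, y}" "closed_segment x y edge_of P"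
    by (auto simp: polytope_edges_def)
  then have "closed_segment u v edge_of P"
    by (auto simp: doubleton_eq_iff closed_segment_commute)
  then have face: "closed_segment u v face_of P" by (simp add: edge_of_def)
  have mid: "midpoint u v \<in> closed_segment u v" by (rule midpoint_in_closed_segment)
  have "midpoint u v = midpoint w w'" using sum by (simp add: midpoint_def)
  then have "midpoint u v \<in> open_segment w w'"
    using distinct(1) by (simp add: midpoint_in_open_segment)
  then have "w \<in> closed_segment u v"
    using mid face vert unfolding face_of_def polytope_vertices_def extreme_point_of_def by blast
  then have "w \<in> open_segment u v" using distinct by (simp add: open_segment_def)
  then show False using vert by (auto simp: polytope_vertices_def extreme_point_of_def)
qed

text \<open>The points are \<open>d\<close> orthonormal vectors, the origin and, for each of
  \<open>\<gamma>\<close> disjoint triples of the vectors, the fourth vertex of a parallelogram. The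
  origin and the vectors outside the triples are the apexes of the pyramids.\<close>

lemma ex_polytope_with_squares:
  assumes d: "d \<le> DIM('a::euclidean_space)" "3 * \<gamma> \<le> d"
  obtains P :: "'a::euclidean_space set" and v :: "nat \<Rightarrow> 'a::euclidean_space"
  where "P \<in> polytope_class d \<gamma>" "polytope_vertices P = v ` {..d + \<gamma>}" "inj_on v {..d + \<gamma>}"
    "\<And>i. i < \<gamma> \<Longrightarrow> v (3 * i) + v (3 * i + 1) = v (3 * i + 2) + v (d + 1 + i)"
proof -
  obtain b where b: "bij_betw b {0..<DIM('a)} (Basis :: 'a set)"
    using ex_bij_betw_nat_finite[OF finite_Basis] by blast
  have bb: "b i \<bullet> b j = (if i = j then 1 else 0)" if "i < d" "j < d" for i j
    using bij_betwE[OF b] bij_betw_imp_inj_on[OF b] that d(1)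
    by (simp add: inner_Basis inj_on_eq_iff)
  define v where "v n = (if n < d then b n else if n = d then 0
      else b (3 * (n - d - 1)) + b (3 * (n - d - 1) + 1) - b (3 * (n - d - 1) + 2))" for n
  define S where "S = v ` {..d + \<gamma>}"
  have v_b: "v n = b n" if "n < d" for n using that by (simp add: v_def)
  have v_0: "v d = 0" by (simp add: v_def)
  have v_x: "v (d + 1 + i) = b (3 * i) + b (3 * i + 1) - b (3 * i + 2)" for i by (simp add: v_def)
  have cases: "n < d \<or> n = d \<or> (\<exists>i<\<gamma>. n = d + 1 + i)" if "n \<le> d + \<gamma>" for n
  proof -
    have "n = d + 1 + (n - d - 1)" "n - d - 1 < \<gamma>" if "\<not> n < d" "n \<noteq> d"
      using that \<open>n \<le> d + \<gamma>\<close> by auto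
    then show ?thesis by blast
  qed
  have arith [simp]: "3 * i \<noteq> Suc (3 * j)" "3 * i \<noteq> Suc (Suc (3 * j))" "Suc (3 * i) \<noteq> 3 * j"
    "Suc (Suc (3 * i)) \<noteq> 3 * j" "3 * i \<noteq> 2 + 3 * j" "Suc (3 * i) \<noteq> 2 + 3 * j" for i j :: nat
    by presburger+
  have lt: "3 * i < d" "3 * i + 1 < d" "3 * i + 2 < d" if "i < \<gamma>" for i using d(2) that by auto
  have bv: "b j \<bullet> v n = (if n < d then (if j = n then 1 else 0) else if n = d then 0
      else (if j = 3 * (n - d - 1) \<or> j = 3 * (n - d - 1) + 1 then 1
        else if j = 3 * (n - d - 1) + 2 then - 1 else 0))"
    if "j < d" "n \<le> d + \<gamma>" for j n
    using cases[OF that(2)] that(1) lt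
    by (elim disjE exE) (auto simp: v_b v_0 v_x[simplified] inner_diff_right inner_add_right bb)
  \<comment> \<open>A functional with a unique maximum at \<open>v n\<close> shows both that this
    point is a vertex and that the points are distinct.\<close>
  have sep: "\<exists>a. \<forall>m\<le>d + \<gamma>. m \<noteq> n \<longrightarrow> a \<bullet> v m < a \<bullet> v n" if n: "n \<le> d + \<gamma>" for n
  proof -
    consider i where "i < \<gamma>" "n = 3 * i" | i where "i < \<gamma>" "n = 3 * i + 1"
      | "n < d" "\<And>i. i < \<gamma> \<Longrightarrow> n \<noteq> 3 * i \<and> n \<noteq> 3 * i + 1" | "n = d" | i where "i < \<gamma>" "n = d + 1 + i"
      using cases[OF n] by blast
    then show ?thesis
    proof cases
      \<comment> \<open>The fourth vertex of the parallelogram also has entry 1 at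
        \<open>3 * i\<close>; subtracting coordinate \<open>3 * i + 1\<close> tells it
        apart.\<close>
      case (1 i)
      then show ?thesis using lt[OF 1(1)]
        by (intro exI[of _ "b (3 * i) - b (3 * i + 1)"]) (auto simp: inner_diff_left bv)
    next
      case (2 i)
      then show ?thesis using lt[OF 2(1)]
        by (intro exI[of _ "b (3 * i + 1) - b (3 * i)"]) (auto simp: inner_diff_left bv)
    next
      case 3
      have "b n \<bullet> v m < b n \<bullet> v n" if m: "m \<le> d + \<gamma>" "m \<noteq> n" for m
        using cases[OF m(1)] 3 m by (auto simp: bv n)
      then show ?thesis by blast
    next
      \<comment> \<open>Every point other than the origin has coordinate sum 1.\<close>
      case 4
      have "(- (\<Sum>j<d. b j)) \<bullet> v m < 0" if m: "m \<le> d + \<gamma>" "m \<noteq> n" for m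
        using cases[OF m(1)]
      proof (elim disjE exE conjE)
        assume "m < d"
        then show ?thesis using bb by (simp add: v_b inner_sum_left)
      next
        fix i assume i: "i < \<gamma>" "m = d + 1 + i"
        have "(\<Sum>j<d. b j \<bullet> b l) = 1" if "l < d" for l
          using that by (simp add: bb)
        then show ?thesis
          using lt[OF i(1)] unfolding i(2) v_x
          by (simp add: inner_sum_left inner_diff_right inner_add_right sum.distrib sum_subtractf)
      qed (use m 4 in simp)
      then show ?thesis using 4 v_0 by (intro exI[of _ "- (\<Sum>j<d. b j)"]) simp
    next
      case (5 i)
      have "(- b (3 * i + 2)) \<bullet> v m < (- b (3 * i + 2)) \<bullet> v n" if m: "m \<le> d + \<gamma>" "m \<noteq> n" for m
        using cases[OF m(1)] 5 m lt[OF 5(1)] n by (auto simp: bv)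
      then show ?thesis by blast
    qed
  qed
  have inj: "inj_on v {..d + \<gamma>}"
    by (rule inj_onI) (metis sep atMost_iff less_irrefl)
  have "w \<notin> convex hull (S - {w})" if "w \<in> S" for w
  proof -
    obtain n where n: "n \<le> d + \<gamma>" "w = v n" using \<open>w \<in> S\<close> by (auto simp: S_def)
    obtain a where a: "\<forall>m\<le>d + \<gamma>. m \<noteq> n \<longrightarrow> a \<bullet> v m < a \<bullet> v n" using sep[OF n(1)] by blast
    show ?thesis
      using a n by (intro not_in_convex_hull_if_separated[of _ a]) (auto simp: S_def)
  qed
  then have vert: "polytope_vertices (convex hull S) = S"
    unfolding polytope_vertices_def
    by (subst extreme_point_of_convex_hull_convex_independent) (auto simp: S_def finite_imp_compact)
  have "dim S = d"
  proof (rule dim_unique[of "b ` {..<d}"])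
    show "b ` {..<d} \<subseteq> S"
    proof
      fix w assume "w \<in> b ` {..<d}"
      then obtain j where "j < d" "w = v j" by (auto simp: v_b)
      then show "w \<in> S" by (simp add: S_def)
    qed
    show "S \<subseteq> span (b ` {..<d})"
    proof
      fix w assume "w \<in> S"
      then obtain n where n: "n \<le> d + \<gamma>" "w = v n" by (auto simp: S_def)
      have base: "b j \<in> span (b ` {..<d})" if "j < d" for j using that by (simp add: span_base)
      show "w \<in> span (b ` {..<d})"
        using cases[OF n(1)]
      proof (elim disjE exE conjE)
        fix i assume i: "i < \<gamma>" "n = d + 1 + i"
        show ?thesis unfolding n(2) i(2) v_x using base lt[OF i(1)] by (intro span_diff span_add)
      qed (simp_all add: n(2) v_b v_0 base span_zero)
    qed
    have "b ` {..<d} \<subseteq> Basis" using bij_betwE[OF b] d(1) by auto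
    then show "independent (b ` {..<d})" using independent_Basis independent_mono by blast
    show "card (b ` {..<d}) = d"
      using bij_betw_imp_inj_on[OF b] d(1) by (subst card_image) (auto intro: inj_on_subset)
  qed
  moreover have "0 \<in> S" unfolding S_def using v_0 by (intro image_eqI[of _ _ d]) auto
  ultimately have "aff_dim (convex hull S) = int d"
    by (simp add: aff_dim_convex_hull aff_dim_zero hull_inc)
  moreover have "card S = d + \<gamma> + 1" unfolding S_def using inj by (simp add: card_image)
  moreover have "polytope (convex hull S)" by (simp add: S_def polytope_convex_hull)
  ultimately have "convex hull S \<in> polytope_class d \<gamma>"
    using vert by (simp add: polytope_class_def)
  moreover have "v (3 * i) + v (3 * i + 1) = v (3 * i + 2) + v (d + 1 + i)" if "i < \<gamma>" for i
    unfolding v_x using lt[OF that] by (simp add: v_b)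
  ultimately show thesis using that vert inj by (simp add: S_def)
qed

section \<open>Comparing the two bounds\<close>

lemma finite_polytope_linked:
  fixes P :: "'a::euclidean_space set"
  assumes "polytope P"
  shows "finite {k. polytope_linked P k}"
proof (rule finite_subset)
  show "{k. polytope_linked P k} \<subseteq> {..card (polytope_vertices P)}"
    by (auto simp: polytope_linked_def k_linked_def)
qed simp

lemma linkedness_ge:
  fixes P :: "'a::euclidean_space set"
  assumes "P \<in> polytope_class d \<gamma>" "2 * k + \<gamma> \<le> d + 1"
  shows "k \<le> linkedness P"
  unfolding linkedness_def
  using assms polytope_linked_lower_bound finite_polytope_linked
  by (intro Max_ge) (auto simp: polytope_class_def)

text \<open>For \<open>k' > k\<close> the hypotheses give
  \<open>4 * \<gamma> \<le> d + 2 - \<gamma> \<le> 2 * k'\<close>, so all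
  \<open>2 * \<gamma>\<close> diagonals fit among the \<open>k'\<close> pairs; and
  \<open>2 * k' + 2 * \<gamma>\<close> exceeds the number of vertices.\<close>

lemma ex_small_linkedness:
  assumes d: "d \<le> DIM('a::euclidean_space)" and \<gamma>: "5 * \<gamma> \<le> d + 2" "d + 1 < 2 * k + \<gamma> + 2"
  obtains P :: "'a::euclidean_space set" where "P \<in> polytope_class d \<gamma>" "linkedness P \<le> k"
proof -
  have "3 * \<gamma> \<le> d" using \<gamma>(1) by (cases "\<gamma> = 0") auto
  then obtain P :: "'a set" and v where P: "P \<in> polytope_class d \<gamma>"
    and v: "polytope_vertices P = v ` {..d + \<gamma>}" "inj_on v {..d + \<gamma>}"
    and square: "\<And>i. i < \<gamma> \<Longrightarrow> v (3 * i) + v (3 * i + 1) = v (3 * i + 2) + v (d + 1 + i)"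
    using ex_polytope_with_squares[OF d] by blast
  \<comment> \<open>Indices below \<open>\<gamma>\<close> give the diagonals from
    \<open>3 * i\<close> to \<open>3 * i + 1\<close>; the index \<open>\<gamma> + l\<close> gives
    the other diagonal of parallelogram \<open>l\<close>, from \<open>3 * l + 2\<close> to
    \<open>d + 1 + l\<close>.\<close>
  define p where "p i = (if i < \<gamma> then 3 * i else 3 * (i - \<gamma>) + 2)" for i
  define p' where "p' i = (if i < \<gamma> then 3 * i + 1 else d + 1 + (i - \<gamma>))" for i
  have p: "p i \<le> d + \<gamma>" "p' i \<le> d + \<gamma>" if "i < 2 * \<gamma>" for i
    using that \<open>3 * \<gamma> \<le> d\<close> by (auto simp: p_def p'_def)
  have v_eq: "v a = v b \<longleftrightarrow> a = b" if "a \<le> d + \<gamma>" "b \<le> d + \<gamma>" for a b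
    using v(2) that by (simp add: inj_on_eq_iff)
  have vert: "v a \<in> polytope_vertices P" if "a \<le> d + \<gamma>" for a using that v(1) by simp
  have rep: "(i < \<gamma> \<and> p i = 3 * i \<and> p' i = 3 * i + 1) \<or> (\<exists>l<\<gamma>. i = \<gamma> + l \<and> p i = 3 * l + 2 \<and> p' i = d + 1 + l)"
    if "i < 2 * \<gamma>" for i
  proof (cases "i < \<gamma>")
    case False
    then show ?thesis using that by (intro disjI2 exI[of _ "i - \<gamma>"]) (simp add: p_def p'_def)
  qed (simp add: p_def p'_def)
  have inj: "p i = p j \<longleftrightarrow> i = j" "p' i = p' j \<longleftrightarrow> i = j" "p i \<noteq> p' j" if "i < 2 * \<gamma>" "j < 2 * \<gamma>" for i j
  proof -
    have ne: "3 * x \<noteq> 3 * y + 1" "3 * x \<noteq> 3 * y + 2" "3 * x + 2 \<noteq> 3 * y" "3 * x + 2 \<noteq> 3 * y + 1" for x y :: nat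
      by presburger+
    have lt: "3 * x < d" "3 * x + 1 < d" "3 * x + 2 < d" if "x < \<gamma>" for x using that \<open>3 * \<gamma> \<le> d\<close> by simp_all
    show "p i = p j \<longleftrightarrow> i = j"
      using rep[OF that(1)] rep[OF that(2)] by (elim disjE exE conjE) (simp_all add: ne del: add_2_eq_Suc')
    show "p' i = p' j \<longleftrightarrow> i = j"
    proof -
      have "3 * x + 1 \<noteq> d + 1 + y" "d + 1 + y \<noteq> 3 * x + 1" if "x < \<gamma>" for x y using lt[OF that] by simp_all
      then show ?thesis
        using rep[OF that(1)] rep[OF that(2)] by (elim disjE exE conjE) simp_all
    qed
    have "3 * x \<noteq> d + 1 + y" "3 * x + 2 \<noteq> d + 1 + y" if "x < \<gamma>" for x y using lt[OF that] by simp_all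
    then show "p i \<noteq> p' j"
      using rep[OF that(1)] rep[OF that(2)]
      by (elim disjE exE conjE) (simp_all add: ne del: add_2_eq_Suc' One_nat_def add_Suc_right)
  qed
  have non_edge: "{v (p i), v (p' i)} \<notin> polytope_edges P" if "i < 2 * \<gamma>" for i
  proof (cases "i < \<gamma>")
    case True
    let ?q = "3 * i + 2" and ?q' = "d + 1 + i"
    have "?q \<le> d + \<gamma>" "?q' \<le> d + \<gamma>" "?q \<noteq> ?q'" "?q \<noteq> p i" "?q \<noteq> p' i"
      using True \<open>3 * \<gamma> \<le> d\<close> by (auto simp: p_def p'_def)
    moreover have "v (p i) + v (p' i) = v ?q + v ?q'" using square[OF True] True by (simp add: p_def p'_def)
    ultimately show ?thesis
      using p[OF that] by (intro diagonal_not_edge[of _ _ _ "v ?q" "v ?q'"]) (simp_all add: vert v_eq)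
  next
    case False
    let ?j = "i - \<gamma>"
    let ?q = "3 * ?j" and ?q' = "3 * ?j + 1"
    have j: "?j < \<gamma>" using False that by simp
    then have "?q \<le> d + \<gamma>" "?q' \<le> d + \<gamma>" "?q \<noteq> ?q'" "?q \<noteq> p i" "?q \<noteq> p' i"
      using False \<open>3 * \<gamma> \<le> d\<close> by (auto simp: p_def p'_def)
    moreover have "v (p i) + v (p' i) = v ?q + v ?q'" using square[OF j] False by (simp add: p_def p'_def)
    ultimately show ?thesis
      using p[OF that] by (intro diagonal_not_edge[of _ _ _ "v ?q" "v ?q'"]) (simp_all add: vert v_eq)
  qed
  have not: "\<not> polytope_linked P k'" if "k < k'" for k'
    unfolding polytope_linked_def
  proof (rule not_k_linked[of "v \<circ> p" "2 * \<gamma>" _ "v \<circ> p'"])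
    show "(v \<circ> p) ` {..<2 * \<gamma>} \<subseteq> polytope_vertices P" "(v \<circ> p') ` {..<2 * \<gamma>} \<subseteq> polytope_vertices P"
      using vert p by auto
    show "inj_on (v \<circ> p) {..<2 * \<gamma>}" "inj_on (v \<circ> p') {..<2 * \<gamma>}"
      using v_eq p inj by (auto intro!: inj_onI)
    show "(v \<circ> p) ` {..<2 * \<gamma>} \<inter> (v \<circ> p') ` {..<2 * \<gamma>} = {}"
      using v_eq p inj(3) by auto
    show "{(v \<circ> p) i, (v \<circ> p') i} \<notin> polytope_edges P" if "i < 2 * \<gamma>" for i
      using non_edge[OF that] by simp
    show "2 * \<gamma> \<le> k'" using that \<gamma> by linarith
    show "card (polytope_vertices P) < 2 * k' + 2 * \<gamma>"
      using P that \<gamma>(2) by (simp add: polytope_class_def)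
  qed
  \<comment> \<open>This makes the set of admissible \<open>k\<close> non-empty, so that its maximum
    is attained.\<close>
  have "polytope_linked P 0"
    using P polytope_vertices_props(1) by (auto simp: polytope_linked_def k_linked_def polytope_class_def)
  moreover have "finite {k. polytope_linked P k}"
    using P finite_polytope_linked by (auto simp: polytope_class_def)
  ultimately have "linkedness P \<in> {k. polytope_linked P k}"
    unfolding linkedness_def by (intro Max_in) auto
  then have "linkedness P \<le> k" using not by (meson mem_Collect_eq not_le)
  then show thesis using that P by blast
qed

theorem theorem3p6:
  fixes d \<gamma> :: nat
  assumes ambient: "d \<le> DIM('a::euclidean_space)"
    and gamma: "real \<gamma> \<le> (real d + 2) / 5"
  shows "int (min_linkedness TYPE('a) d \<gamma>) = \<lfloor>(real d - real \<gamma> + 1) / 2\<rfloor>"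
proof -
  have "real (5 * \<gamma>) \<le> real (d + 2)" using gamma by simp
  then have \<gamma>: "5 * \<gamma> \<le> d + 2" by (simp only: of_nat_le_iff)
  then have le: "\<gamma> \<le> d + 1" by simp
  \<comment> \<open>By \<open>le\<close> the subtraction of natural numbers does not
    truncate.\<close>
  define k where "k = (d + 1 - \<gamma>) div 2"
  have k: "2 * k + \<gamma> \<le> d + 1" "d + 1 < 2 * k + \<gamma> + 2" using le by (auto simp: k_def)
  obtain P :: "'a set" where P: "P \<in> polytope_class d \<gamma>" "linkedness P \<le> k"
    using ex_small_linkedness[OF ambient \<gamma> k(2)] by blast
  have "min_linkedness TYPE('a) d \<gamma> = k"
    unfolding min_linkedness_def
  proof (rule Max_eqI)
    show "k \<in> {k. \<forall>P\<in>polytope_class d \<gamma> :: 'a set set. k \<le> linkedness P}"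
      using linkedness_ge k(1) by blast
    show "k' \<le> k" if "k' \<in> {k. \<forall>P\<in>polytope_class d \<gamma> :: 'a set set. k \<le> linkedness P}" for k'
      using that P by force
    \<comment> \<open>The bound by \<open>k\<close> just shown also makes the set finite, as
      \<open>Max\<close> requires.\<close>
    then show "finite {k. \<forall>P\<in>polytope_class d \<gamma> :: 'a set set. k \<le> linkedness P}"
      by (meson atMost_iff finite_atMost finite_subset subsetI)
  qed
  moreover have "(real d - real \<gamma> + 1) / 2 = real (d + 1 - \<gamma>) / real 2"
    using le by (simp add: of_nat_diff)
  ultimately show ?thesis
    by (simp only: k_def floor_divide_of_nat_eq)
qed

end
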